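(* Let $\mathcal{A}$ be a finite real central hyperplane arrangement in $\mathbb{R}^3$ (a finite set of $2$-dimensional linear subspaces of $\mathbb{R}^3$) such that all the regions of $\mathcal{A}$ are isometric to one another. Then $\mathcal{A}$ is a Coxeter arrangement.
   Context: The regions of $\mathcal{A}$ are the connected components of $\mathbb{R}^3\setminus\bigcup_{H\in\mathcal{A}}H$; "all regions isometric" means any two regions are images of each other under a Euclidean isometry of $\mathbb{R}^3$. A Coxeter arrangement is the set of reflecting hyperplanes of all reflections in a finite Euclidean reflection group; equivalently, a finite set $\mathcal{A}$ of linear hyperplanes such that for every $H\in\mathcal{A}$, the orthogonal reflection fixing $H$ permutes $\mathcal{A}$ (a closed system of mirrors). *)

theory Defs
  imports
    "HOL-Analysis.Analysis"
    "HOL-Algebra.Bij"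
    "HOL-Algebra.Generated_Groups"
begin

definition regions :: "'a::euclidean_space set set \<Rightarrow> 'a set set" where
  "regions A = components (UNIV - \<Union> A)"

definition euclidean_isometry :: "('a::euclidean_space \<Rightarrow> 'a) \<Rightarrow> bool" where
  "euclidean_isometry f \<longleftrightarrow> bij f \<and> (\<forall>x y. dist (f x) (f y) = dist x y)"

definition reflection_along :: "'a::euclidean_space \<Rightarrow> 'a \<Rightarrow> 'a" where
  "reflection_along v x = x - (2 * (v \<bullet> x) / (v \<bullet> v)) *\<^sub>R v"

definition is_reflection :: "('a::euclidean_space \<Rightarrow> 'a) \<Rightarrow> bool" where
  "is_reflection s \<longleftrightarrow> (\<exists>v. v \<noteq> 0 \<and> s = reflection_along v)"

definition mirror :: "('a::euclidean_space \<Rightarrow> 'a) \<Rightarrow> 'a set" where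
  "mirror s = {x. s x = x}"

text \<open>The ambient group is that of all bijections of the space; a subgroup generated by
  linear reflections automatically consists of orthogonal transformations. No essentiality is
  required, and the trivial group (generated by no reflections) is included.\<close>

definition finite_reflection_group :: "('a::euclidean_space \<Rightarrow> 'a) set \<Rightarrow> bool" where
  "finite_reflection_group W \<longleftrightarrow>
     finite W \<and> (\<exists>S. (\<forall>s\<in>S. is_reflection s) \<and> W = generate (BijGroup UNIV) S)"

definition coxeter_arrangement :: "'a::euclidean_space set set \<Rightarrow> bool" where
  "coxeter_arrangement A \<longleftrightarrow>
     (\<exists>W. finite_reflection_group W \<and> A = mirror ` {s \<in> W. is_reflection s})"

lemma mirror_reflection_along:
  assumes "v \<noteq> 0"
  shows "mirror (reflection_along v) = {x. v \<bullet> x = 0}"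
  using assms by (auto simp: mirror_def reflection_along_def)

lemma reflection_along_involution:
  "reflection_along v (reflection_along v x) = x"
  by (cases "v = 0")
    (simp_all add: reflection_along_def inner_diff_right flip: scaleR_left_distrib)

lemma is_reflection_in_BijGroup:
  assumes "is_reflection s"
  shows "s \<in> carrier (BijGroup UNIV)"
proof -
  obtain v where "s = reflection_along v"
    using assms by (auto simp: is_reflection_def)
  then have "bij s"
    by (intro o_bij[of s]) (auto simp: reflection_along_involution)
  then show ?thesis
    by (simp add: BijGroup_def Bij_def)
qed

lemma orthogonal_transformation_is_reflection:
  assumes "is_reflection s"
  shows "orthogonal_transformation s"
proof -
  obtain v where v: "v \<noteq> 0" "s = reflection_along v"
    using assms by (auto simp: is_reflection_def)
  have "linear s"
    unfolding v(2) reflection_along_def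
    by (intro linearI) (simp_all add: inner_add_right algebra_simps add_divide_distrib)
  moreover have "s x \<bullet> s y = x \<bullet> y" for x y
    using v(1) unfolding v(2) reflection_along_def
    by (simp add: inner_diff_left inner_diff_right inner_commute field_simps)
  ultimately show ?thesis
    by (simp add: orthogonal_transformation_def)
qed

end

theory Submission
  imports Defs
begin

text \<open>
An inclusion-minimal simplicial cone bounded by planes of an essential arrangement is a
region, so all regions are simplicial cones, that is, congruent spherical triangles. Let
\<open>M\<close> be the multiset of the cosines of their sides. Around a vertex \<open>v\<close> the triangles
have their edges at \<open>v\<close> with cosines \<open>x i\<close> and their edges opposite to \<open>v\<close> with
cosines \<open>y i\<close>; consecutive triangles share an edge, \<open>x i\<close>, \<open>x (i + 1)\<close>, \<open>y i\<close>
exhaust \<open>M\<close>, and the angle at \<open>v\<close> is an injective function \<open>\<phi>\<close> of \<open>y i\<close>.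
The angles are invariant under half a turn and sum to \<open>\<pi>\<close> over half a turn, whereas the
angles of a spherical triangle sum to more than \<open>\<pi>\<close>. Counting parities along half a turn then
forces all \<open>y i\<close> to be equal, hence the \<open>x i\<close> to alternate, hence the reflection in each
wall of a region maps this region to its neighbour. Walking along galleries, every plane of the
arrangement is the mirror of a symmetry of the arrangement. An arrangement of rank two becomes
essential by adding the plane orthogonal to the common line.
\<close>

section \<open>Triples of vectors and open simplicial cones\<close>

text \<open>Congruence is much weaker than symmetry: an isometry between two regions need not
  respect the rest of the arrangement, and neighbouring triangles may be glued with their labels
  arranged differently. Hence no types of vertices are assumed; only the multiset of cosines is
  kept. The obstacle is a vertex around which two different angles occur. There the parity count
  yields labels \<open>p\<close>, \<open>q\<close> with \<phi> p + \<phi> q \<le> pi / 2. Both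
  alternatives bound every angle at the vertex by pi / 2. Applied at the three vertices of one
  triangle, this bounds all three angles, and then the angle sum \<phi> p + \<phi> q + \<phi> r
  could not exceed pi. Two further points need an argument. The given isometries may involve
  translations; these are scaled away because regions are cones. And a system of planes closed under
  its reflections is Coxeter in the sense of the definition only if the generated group is finite
  and contains no reflection with a new mirror; a polynomial that changes sign under every
  reflection excludes new mirrors.\<close>

definition det3 :: "real^3 \<Rightarrow> real^3 \<Rightarrow> real^3 \<Rightarrow> real" where
  "det3 a b c = a \<bullet> cross3 b c"

lemma det3_components: "det3 a b c = a$1 * (b$2 * c$3 - b$3 * c$2) + a$2 * (b$3 * c$1 - b$1 * c$3)
   + a$3 * (b$1 * c$2 - b$2 * c$1)"
  by (simp add: det3_def cross3_def inner_vec_def sum_3)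

lemma det3_swap: "det3 b a c = - det3 a b c" "det3 a c b = - det3 a b c"
  by (simp_all add: det3_components algebra_simps)

lemma det3_eq_0_iff_swap: "det3 b a c = 0 \<longleftrightarrow> det3 a b c = 0" "det3 a c b = 0 \<longleftrightarrow> det3 a b c = 0"
  by (metis det3_swap(1) neg_equal_0_iff_equal, metis det3_swap(2) neg_equal_0_iff_equal)

text \<open>Cramer's rule with the denominator cleared, so that it is a polynomial identity.\<close>

lemma det3_expand:
  "det3 a b c *\<^sub>R y = det3 y b c *\<^sub>R a + det3 a y c *\<^sub>R b + det3 a b y *\<^sub>R c"
  unfolding vec_eq_iff forall_3 vector_add_component vector_scaleR_component real_scaleR_def det3_components
  by (intro conjI; algebra)

text \<open>The Gram determinant. It depends on inner products only, so orthogonal maps preserve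
  independence; for unit vectors it is the last expression in
  \<open>spherical_sides\<close>.\<close>

lemma det3_square:
  "(det3 a b c)\<^sup>2 = (a \<bullet> a) * (b \<bullet> b) * (c \<bullet> c) + 2 * (a \<bullet> b) * (b \<bullet> c) * (a \<bullet> c)
     - (a \<bullet> a) * (b \<bullet> c)\<^sup>2 - (b \<bullet> b) * (a \<bullet> c)\<^sup>2 - (c \<bullet> c) * (a \<bullet> b)\<^sup>2"
  unfolding det3_components inner_vec_def sum_3 inner_real_def by algebra

lemma det3_coordinates:
  assumes "det3 a b c \<noteq> 0"
  obtains \<alpha> \<beta> \<gamma> where "y = \<alpha> *\<^sub>R a + \<beta> *\<^sub>R b + \<gamma> *\<^sub>R c"
proof -
  have "y = (1 / det3 a b c) *\<^sub>R (det3 a b c *\<^sub>R y)"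
    using assms by simp
  also have "\<dots> = (det3 y b c / det3 a b c) *\<^sub>R a + (det3 a y c / det3 a b c) *\<^sub>R b
      + (det3 a b y / det3 a b c) *\<^sub>R c"
    by (subst det3_expand) (simp add: scaleR_add_right)
  finally show ?thesis
    by (rule that)
qed

lemma det3_combination_eq_0D:
  assumes "det3 a b c \<noteq> 0" "\<alpha> *\<^sub>R a + \<beta> *\<^sub>R b + \<gamma> *\<^sub>R c = 0"
  shows "\<alpha> = 0" "\<beta> = 0" "\<gamma> = 0"
proof -
  have "(\<alpha> *\<^sub>R a + \<beta> *\<^sub>R b + \<gamma> *\<^sub>R c) \<bullet> cross3 b c = \<alpha> * det3 a b c"
    "(\<alpha> *\<^sub>R a + \<beta> *\<^sub>R b + \<gamma> *\<^sub>R c) \<bullet> cross3 c a = \<beta> * det3 a b c"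
    "(\<alpha> *\<^sub>R a + \<beta> *\<^sub>R b + \<gamma> *\<^sub>R c) \<bullet> cross3 a b = \<gamma> * det3 a b c"
    by (simp_all add: inner_add_left dot_cross_self)
      (simp_all add: det3_components cross3_def inner_vec_def sum_3, algebra+)
  then show "\<alpha> = 0" "\<beta> = 0" "\<gamma> = 0"
    using assms by auto
qed

lemma det3_orthogonal_eq_0:
  assumes "det3 a b c \<noteq> 0" "n \<bullet> a = 0" "n \<bullet> b = 0" "n \<bullet> c = 0"
  shows "n = 0"
proof -
  obtain \<alpha> \<beta> \<gamma> where "n = \<alpha> *\<^sub>R a + \<beta> *\<^sub>R b + \<gamma> *\<^sub>R c"
    by (rule det3_coordinates[OF assms(1)])
  from arg_cong[OF this, of "\<lambda>x. n \<bullet> x"]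
  have "n \<bullet> n = \<alpha> * (n \<bullet> a) + \<beta> * (n \<bullet> b) + \<gamma> * (n \<bullet> c)"
    by (simp add: inner_add_right)
  then show ?thesis
    using assms by simp
qed

text \<open>A combination of \<open>m\<close> and \<open>n\<close> that also kills \<open>c\<close>
  is orthogonal to a basis, hence zero. The lemma serves to recognise a wall from two edges lying in
  it.\<close>

lemma unit_orthogonal_unique:
  assumes "det3 a b c \<noteq> 0" "norm m = 1" "norm n = 1"
    and "m \<bullet> a = 0" "m \<bullet> b = 0" "n \<bullet> a = 0" "n \<bullet> b = 0"
  shows "m = n \<or> m = - n"
proof -
  have mc: "n \<bullet> c \<noteq> 0" "m \<bullet> c \<noteq> 0"
    using det3_orthogonal_eq_0[OF assms(1)] assms by (metis norm_zero zero_neq_one)+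
  have "(m \<bullet> c) *\<^sub>R n - (n \<bullet> c) *\<^sub>R m = 0"
    by (rule det3_orthogonal_eq_0[OF assms(1)]) (simp_all add: inner_diff_left assms)
  then have eq: "(m \<bullet> c) *\<^sub>R n = (n \<bullet> c) *\<^sub>R m"
    by simp
  then have "\<bar>m \<bullet> c\<bar> = \<bar>n \<bullet> c\<bar>"
    using assms(2,3) by (metis mult.right_neutral norm_scaleR)
  then consider "m \<bullet> c = n \<bullet> c" | "m \<bullet> c = - (n \<bullet> c)"
    by linarith
  then show ?thesis
  proof cases
    case 1
    show ?thesis using eq[unfolded 1] mc by (metis scaleR_cancel_left)
  next
    case 2
    have "(n \<bullet> c) *\<^sub>R (m + n) = 0"
      unfolding scaleR_add_right eq[unfolded 2, symmetric] by simp
    then show ?thesis using mc by (simp add: eq_neg_iff_add_eq_0)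
  qed
qed

section \<open>Open simplicial cones\<close>

definition ocone :: "real^3 \<Rightarrow> real^3 \<Rightarrow> real^3 \<Rightarrow> (real^3) set" where
  "ocone a b c = {\<alpha> *\<^sub>R a + \<beta> *\<^sub>R b + \<gamma> *\<^sub>R c |\<alpha> \<beta> \<gamma>. 0 < \<alpha> \<and> 0 < \<beta> \<and> 0 < \<gamma>}"

lemma ocone_memI: "0 < \<alpha> \<Longrightarrow> 0 < \<beta> \<Longrightarrow> 0 < \<gamma> \<Longrightarrow> \<alpha> *\<^sub>R a + \<beta> *\<^sub>R b + \<gamma> *\<^sub>R c \<in> ocone a b c"
  unfolding ocone_def by blast

lemma ocone_swap: "ocone b a c = ocone a b c" "ocone a c b = ocone a b c"
proof -
  have 1: "ocone b a c \<subseteq> ocone a b c" for a b c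
  proof
    fix x assume "x \<in> ocone b a c"
    then obtain \<alpha> \<beta> \<gamma> where "0 < \<alpha>" "0 < \<beta>" "0 < \<gamma>" "x = \<alpha> *\<^sub>R b + \<beta> *\<^sub>R a + \<gamma> *\<^sub>R c"
      unfolding ocone_def by blast
    then show "x \<in> ocone a b c"
      using ocone_memI[of \<beta> \<alpha> \<gamma> a b c] by (simp add: add_ac)
  qed
  have 2: "ocone a c b \<subseteq> ocone a b c" for a b c
  proof
    fix x assume "x \<in> ocone a c b"
    then obtain \<alpha> \<beta> \<gamma> where "0 < \<alpha>" "0 < \<beta>" "0 < \<gamma>" "x = \<alpha> *\<^sub>R a + \<beta> *\<^sub>R c + \<gamma> *\<^sub>R b"
      unfolding ocone_def by blast
    then show "x \<in> ocone a b c"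
      using ocone_memI[of \<alpha> \<gamma> \<beta> a b c] by (simp add: add_ac)
  qed
  show "ocone b a c = ocone a b c" "ocone a c b = ocone a b c"
    using 1 2 by blast+
qed

lemma ocone_mem_iff:
  assumes "det3 a b c \<noteq> 0"
  shows "\<alpha> *\<^sub>R a + \<beta> *\<^sub>R b + \<gamma> *\<^sub>R c \<in> ocone a b c \<longleftrightarrow> 0 < \<alpha> \<and> 0 < \<beta> \<and> 0 < \<gamma>"
proof
  assume "\<alpha> *\<^sub>R a + \<beta> *\<^sub>R b + \<gamma> *\<^sub>R c \<in> ocone a b c"
  then obtain \<alpha>' \<beta>' \<gamma>' where pos: "0 < \<alpha>'" "0 < \<beta>'" "0 < \<gamma>'"
    and eq: "\<alpha> *\<^sub>R a + \<beta> *\<^sub>R b + \<gamma> *\<^sub>R c = \<alpha>' *\<^sub>R a + \<beta>' *\<^sub>R b + \<gamma>' *\<^sub>R c"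
    unfolding ocone_def by blast
  from eq have "(\<alpha> - \<alpha>') *\<^sub>R a + (\<beta> - \<beta>') *\<^sub>R b + (\<gamma> - \<gamma>') *\<^sub>R c = 0"
    by (simp add: algebra_simps)
  from det3_combination_eq_0D[OF assms this] show "0 < \<alpha> \<and> 0 < \<beta> \<and> 0 < \<gamma>"
    using pos by simp
qed (simp add: ocone_memI)

lemma ocone_linear_image:
  assumes "linear f"
  shows "f ` ocone a b c = ocone (f a) (f b) (f c)"
proof -
  have "f (\<alpha> *\<^sub>R a + \<beta> *\<^sub>R b + \<gamma> *\<^sub>R c) = \<alpha> *\<^sub>R f a + \<beta> *\<^sub>R f b + \<gamma> *\<^sub>R f c" for \<alpha> \<beta> \<gamma>
    using assms by (simp add: linear_add linear_scale)
  note f = this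
  show ?thesis
  proof (intro equalityI subsetI)
    fix x assume "x \<in> f ` ocone a b c"
    then show "x \<in> ocone (f a) (f b) (f c)"
      unfolding ocone_def[of a] by (auto simp: f intro: ocone_memI)
  next
    fix x assume "x \<in> ocone (f a) (f b) (f c)"
    then obtain \<alpha> \<beta> \<gamma> where "0 < \<alpha>" "0 < \<beta>" "0 < \<gamma>" "x = f (\<alpha> *\<^sub>R a + \<beta> *\<^sub>R b + \<gamma> *\<^sub>R c)"
      unfolding ocone_def f by blast
    then show "x \<in> f ` ocone a b c"
      using ocone_memI by blast
  qed
qed

lemma ocone_scale:
  assumes "0 < k" "0 < l" "0 < r"
  shows "ocone (k *\<^sub>R a) (l *\<^sub>R b) (r *\<^sub>R c) = ocone a b c"
proof (intro equalityI subsetI)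
  fix x assume "x \<in> ocone a b c"
  then obtain \<alpha> \<beta> \<gamma> where p: "0 < \<alpha>" "0 < \<beta>" "0 < \<gamma>" "x = \<alpha> *\<^sub>R a + \<beta> *\<^sub>R b + \<gamma> *\<^sub>R c"
    unfolding ocone_def by blast
  have "(\<alpha>/k) *\<^sub>R k *\<^sub>R a + (\<beta>/l) *\<^sub>R l *\<^sub>R b + (\<gamma>/r) *\<^sub>R r *\<^sub>R c \<in> ocone (k *\<^sub>R a) (l *\<^sub>R b) (r *\<^sub>R c)"
    using p assms by (intro ocone_memI) simp_all
  then show "x \<in> ocone (k *\<^sub>R a) (l *\<^sub>R b) (r *\<^sub>R c)"
    using p assms by simp
next
  fix x assume "x \<in> ocone (k *\<^sub>R a) (l *\<^sub>R b) (r *\<^sub>R c)"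
  then obtain \<alpha> \<beta> \<gamma> where p: "0 < \<alpha>" "0 < \<beta>" "0 < \<gamma>" "x = \<alpha> *\<^sub>R k *\<^sub>R a + \<beta> *\<^sub>R l *\<^sub>R b + \<gamma> *\<^sub>R r *\<^sub>R c"
    unfolding ocone_def by blast
  then show "x \<in> ocone a b c"
    using ocone_memI[of "\<alpha> * k" "\<beta> * l" "\<gamma> * r" a b c] assms by simp
qed

lemma det3_orthogonal_transformation:
  assumes "orthogonal_transformation f"
  shows "(det3 (f a) (f b) (f c))\<^sup>2 = (det3 a b c)\<^sup>2"
  unfolding det3_square using assms by (simp add: orthogonal_transformation_def)

section \<open>Spherical triangles\<close>

text \<open>The angle opposite to the side with cosine \<open>x\<close> in the spherical triangle whose sides have
  cosines \<open>x\<close>, \<open>y\<close>, \<open>z\<close>, by the spherical law of cosines.\<close>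

definition sphere_angle :: "real \<Rightarrow> real \<Rightarrow> real \<Rightarrow> real" where
  "sphere_angle x y z = arccos ((x - y * z) / (sqrt (1 - y\<^sup>2) * sqrt (1 - z\<^sup>2)))"

lemma sphere_angle_commute: "sphere_angle x z y = sphere_angle x y z"
  by (simp add: sphere_angle_def mult.commute)

text \<open>Positive definiteness of the Gram matrix of three unit vectors with these inner
  products; the last expression is its determinant.\<close>

definition spherical_sides :: "real \<Rightarrow> real \<Rightarrow> real \<Rightarrow> bool" where
  "spherical_sides x y z \<longleftrightarrow> x\<^sup>2 < 1 \<and> y\<^sup>2 < 1 \<and> z\<^sup>2 < 1 \<and> 0 < 1 - x\<^sup>2 - y\<^sup>2 - z\<^sup>2 + 2 * x * y * z"

lemma spherical_sides_swap:
  "spherical_sides y x z = spherical_sides x y z"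
  "spherical_sides x z y = spherical_sides x y z"
  by (auto simp: spherical_sides_def algebra_simps)

text \<open>The square of the numerator is (1 - y^2) (1 - z^2) - \<open>D\<close>, so
  \<open>D\<close> > 0 keeps the quotient strictly between -1 and 1. That \<open>D\<close> is
  symmetric in the sides makes the sines of different angles comparable.\<close>

lemma sphere_angle_cos_sin:
  assumes "spherical_sides x y z"
  defines "D \<equiv> 1 - x\<^sup>2 - y\<^sup>2 - z\<^sup>2 + 2 * x * y * z"
  shows "cos (sphere_angle x y z) = (x - y * z) / (sqrt (1 - y\<^sup>2) * sqrt (1 - z\<^sup>2))"
    and "sin (sphere_angle x y z) = sqrt D / (sqrt (1 - y\<^sup>2) * sqrt (1 - z\<^sup>2))"
    and "0 < sphere_angle x y z" "sphere_angle x y z < pi"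
proof -
  let ?k = "sqrt (1 - y\<^sup>2) * sqrt (1 - z\<^sup>2)"
  let ?q = "(x - y * z) / ?k"
  have D: "0 < D" and y: "y\<^sup>2 < 1" and z: "z\<^sup>2 < 1"
    using assms by (auto simp: spherical_sides_def)
  have k: "0 < ?k" "?k\<^sup>2 = (1 - y\<^sup>2) * (1 - z\<^sup>2)"
    using y z by (auto simp: power_mult_distrib)
  have "(x - y * z)\<^sup>2 = ?k\<^sup>2 - D"
    unfolding k(2) D_def by algebra
  moreover have "?k\<^sup>2 \<noteq> 0"
    using k(1) by (metis less_irrefl power_eq_0_iff)
  moreover have "1 - (e / k)\<^sup>2 = D / k\<^sup>2" if "e\<^sup>2 = k\<^sup>2 - D" "k\<^sup>2 \<noteq> 0" for e k :: real
    using that by (simp add: power_divide diff_divide_distrib)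
  ultimately have q: "1 - ?q\<^sup>2 = D / ?k\<^sup>2"
    by blast
  have "0 < D / ?k\<^sup>2"
    using D k(1) by (intro divide_pos_pos zero_less_power)
  then have "?q\<^sup>2 < 1"
    using q by linarith
  then have q1: "\<bar>?q\<bar> < 1"
    by (simp add: abs_square_less_1)
  then show c: "cos (sphere_angle x y z) = ?q"
    unfolding sphere_angle_def by (intro cos_arccos) linarith+
  show p: "0 < sphere_angle x y z" "sphere_angle x y z < pi"
    unfolding sphere_angle_def using arccos_lt_bounded[of ?q] q1 by linarith+
  have "sin (sphere_angle x y z) = sqrt (1 - ?q\<^sup>2)"
    unfolding sphere_angle_def using q1 by (intro sin_arccos) linarith+
  also have "\<dots> = sqrt D / ?k"
    unfolding q using k(1) by (simp add: real_sqrt_divide)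
  finally show "sin (sphere_angle x y z) = sqrt D / ?k" .
qed

text \<open>Converse of the isosceles theorem. By the symmetry of \<open>D\<close>, equal sines give
  1 - x^2 = 1 - y^2; equal cosines then give (x - y) (1 + z) = 0, and z is not -1.\<close>

lemma sphere_angle_inj:
  assumes "spherical_sides x y z" "sphere_angle x y z = sphere_angle y x z"
  shows "x = y"
proof -
  define D where "D = 1 - x\<^sup>2 - y\<^sup>2 - z\<^sup>2 + 2 * x * y * z"
  have s': "spherical_sides y x z"
    using assms(1) by (simp add: spherical_sides_swap)
  have D: "0 < D" and x: "x\<^sup>2 < 1" and y: "y\<^sup>2 < 1" and z: "z\<^sup>2 < 1"
    using assms by (auto simp: spherical_sides_def D_def)
  have D': "1 - y\<^sup>2 - x\<^sup>2 - z\<^sup>2 + 2 * y * x * z = D"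
    unfolding D_def by algebra
  have pos: "0 < sqrt (1 - x\<^sup>2)" "0 < sqrt (1 - y\<^sup>2)" "0 < sqrt (1 - z\<^sup>2)" "0 < sqrt D"
    using D x y z by auto
  have "sqrt D / (sqrt (1 - y\<^sup>2) * sqrt (1 - z\<^sup>2)) = sqrt D / (sqrt (1 - x\<^sup>2) * sqrt (1 - z\<^sup>2))"
    using sphere_angle_cos_sin(2)[OF assms(1)] sphere_angle_cos_sin(2)[OF s'] assms(2)
    unfolding D' D_def[symmetric] by metis
  then have sq: "sqrt (1 - y\<^sup>2) = sqrt (1 - x\<^sup>2)"
    using pos by (metis divide_cancel_left less_irrefl mult_cancel_right)
  have "(x - y * z) / (sqrt (1 - y\<^sup>2) * sqrt (1 - z\<^sup>2)) = (y - x * z) / (sqrt (1 - x\<^sup>2) * sqrt (1 - z\<^sup>2))"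
    using sphere_angle_cos_sin(1)[OF assms(1)] sphere_angle_cos_sin(1)[OF s'] assms(2) by simp
  then have "x - y * z = y - x * z"
    unfolding sq using pos by (simp add: field_simps)
  then have "(x - y) * (1 + z) = 0"
    by (simp add: algebra_simps)
  moreover have "z \<noteq> - 1"
    using z by auto
  ultimately show ?thesis
    by (auto simp: add_eq_0_iff)
qed

text \<open>Otherwise C \<le> pi - (A + B), so cos C + cos (A + B) \<ge> 0 by monotonicity of the
  cosine; over a common denominator the numerator of that sum is -(1 - z) D, which is
  negative.\<close>

lemma sphere_angle_sum_gt_pi:
  assumes s: "spherical_sides x y z"
  shows "pi < sphere_angle x y z + sphere_angle y x z + sphere_angle z x y"
proof (rule ccontr)
  define A where "A = sphere_angle x y z"
  define B where "B = sphere_angle y x z"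
  define C where "C = sphere_angle z x y"
  define D where "D = 1 - x\<^sup>2 - y\<^sup>2 - z\<^sup>2 + 2 * x * y * z"
  have s': "spherical_sides y x z" "spherical_sides z x y"
    using s by (simp_all add: spherical_sides_swap)
  have D: "0 < D" and x: "x\<^sup>2 < 1" and y: "y\<^sup>2 < 1" and z: "z\<^sup>2 < 1"
    using s by (auto simp: spherical_sides_def D_def)
  have D': "1 - y\<^sup>2 - x\<^sup>2 - z\<^sup>2 + 2 * y * x * z = D"
    unfolding D_def by algebra
  define X Y Z where XYZ: "X = sqrt (1 - x\<^sup>2)" "Y = sqrt (1 - y\<^sup>2)" "Z = sqrt (1 - z\<^sup>2)"
  have pos: "0 < X" "0 < Y" "0 < Z"
    using x y z by (auto simp: XYZ)
  have Z2: "Z * Z = 1 - z\<^sup>2"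
    using z by (simp add: XYZ)
  note A = sphere_angle_cos_sin[OF s, folded D_def A_def XYZ]
  note B = sphere_angle_cos_sin[OF s'(1), unfolded D', folded B_def XYZ]
  note C = sphere_angle_cos_sin[OF s'(2), folded C_def XYZ]
  assume "\<not> pi < sphere_angle x y z + sphere_angle y x z + sphere_angle z x y"
  then have "C \<le> pi - (A + B)"
    by (simp add: A_def B_def C_def)
  then have "cos (pi - (A + B)) \<le> cos C"
    using A B C by (intro cos_monotone_0_pi_le) linarith+
  then have "0 \<le> cos C + cos (A + B)"
    by simp
  also have "cos (A + B) = ((x - y * z) * (y - x * z) - sqrt D * sqrt D) / (Z * Z * (X * Y))"
    unfolding cos_add A B using pos by (simp add: field_simps)
  also have "sqrt D * sqrt D = D"
    using D by simp
  also have "cos C = (z - x * y) * (Z * Z) / (Z * Z * (X * Y))"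
    unfolding C using pos by (simp add: field_simps)
  finally have "0 \<le> ((z - x * y) * (Z * Z) + ((x - y * z) * (y - x * z) - D)) / (Z * Z * (X * Y))"
    by (simp add: add_divide_distrib)
  moreover have "0 < Z * Z * (X * Y)"
    using pos by simp
  ultimately have "0 \<le> (z - x * y) * (Z * Z) + ((x - y * z) * (y - x * z) - D)"
    by (simp add: zero_le_divide_iff)
  also have "\<dots> = - ((1 - z) * D)"
    unfolding Z2 D_def by algebra
  finally have "(1 - z) * D \<le> 0"
    by simp
  moreover have "z < 1"
    using z by (simp add: abs_square_less_1)
  ultimately show False
    using D by (simp add: mult_le_0_iff)
qed

lemma mset_triple_eq_iff:
  "{#x, y, z#} = {#a, b, c#} \<longleftrightarrow>
     (x, y, z) \<in> {(a, b, c), (a, c, b), (b, a, c), (b, c, a), (c, a, b), (c, b, a)}"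
  by (auto simp: add_eq_conv_ex)

text \<open>Once the multiset of sides is fixed, the opposite side determines the pair of adjacent
  sides, in which the angle is symmetric. So the cascade defining \<phi> is consistent even if sides
  coincide.\<close>

lemma sphere_angle_as_function:
  assumes "spherical_sides a b c"
  obtains \<phi> where
    "\<And>x y z. {#x, y, z#} = {#a, b, c#} \<Longrightarrow> sphere_angle x y z = \<phi> x"
    "\<And>k. k \<in># {#a, b, c#} \<Longrightarrow> 0 < \<phi> k"
    "inj_on \<phi> (set_mset {#a, b, c#})"
    "pi < (\<Sum>k\<in>#{#a, b, c#}. \<phi> k)"
proof
  define \<phi> where "\<phi> k = (if k = a then sphere_angle a b c else if k = b then sphere_angle b a c
    else sphere_angle c a b)" for k
  show f: "sphere_angle x y z = \<phi> x" if "{#x, y, z#} = {#a, b, c#}" for x y z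
    using that unfolding mset_triple_eq_iff \<phi>_def by (auto simp: sphere_angle_commute)
  have fa: "\<phi> a = sphere_angle a b c" and fb: "\<phi> b = sphere_angle b a c" and fc: "\<phi> c = sphere_angle c a b"
    by (auto simp: \<phi>_def sphere_angle_commute)
  have s: "spherical_sides b a c" "spherical_sides c a b" "spherical_sides a c b" "spherical_sides b c a"
    using assms by (simp_all add: spherical_sides_swap)
  show "0 < \<phi> k" if "k \<in># {#a, b, c#}" for k
    using that sphere_angle_cos_sin(3)[OF assms] sphere_angle_cos_sin(3)[OF s(1)]
      sphere_angle_cos_sin(3)[OF s(2)] by (auto simp: fa fb fc)
  show "pi < (\<Sum>k\<in>#{#a, b, c#}. \<phi> k)"
    using sphere_angle_sum_gt_pi[OF assms] by (simp add: fa fb fc)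
  have "\<phi> a = \<phi> b \<Longrightarrow> a = b"
    unfolding fa fb using sphere_angle_inj[OF assms] by simp
  moreover have "\<phi> a = \<phi> c \<Longrightarrow> a = c"
    unfolding fa fc using sphere_angle_inj[OF s(3)] by (simp add: sphere_angle_commute)
  moreover have "\<phi> b = \<phi> c \<Longrightarrow> b = c"
    unfolding fb fc using sphere_angle_inj[OF s(4)] by (simp add: sphere_angle_commute)
  ultimately show "inj_on \<phi> (set_mset {#a, b, c#})"
    unfolding inj_on_def set_mset_add_mset_insert set_mset_empty by (metis empty_iff insert_iff)
qed

section \<open>Labellings around a vertex\<close>

text \<open>The link of a vertex: going around it, the edges at the vertex have cosines \<open>x i\<close>, the
  opposite edges have cosines \<open>y i\<close>, and every triangle has the same multiset of cosines.
  Half a turn is a closed walk up to the central symmetry, so a parity count applies.\<close>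

lemma cyclic_labelling_dichotomy:
  fixes x y :: "nat \<Rightarrow> real" and \<phi> :: "real \<Rightarrow> real"
  assumes M: "\<And>i. {#x i, x (Suc i), y i#} = M"
    and pos: "\<And>k. k \<in># M \<Longrightarrow> 0 < \<phi> k"
    and inj: "inj_on \<phi> (set_mset M)"
    and large: "s < (\<Sum>k\<in>#M. \<phi> k)"
    and per: "\<And>i. \<phi> (y (i + m)) = \<phi> (y i)"
    and total: "(\<Sum>i<m. \<phi> (y i)) = s" and m: "0 < m"
  shows "(\<forall>i. y i = y 0) \<or>
    (\<exists>p q r. M = {#p, q, r#} \<and> 2 * \<phi> p + 2 * \<phi> q \<le> s \<and> (\<forall>i. y i \<in> {p, q}))"
proof -
  have yM: "y i \<in># M" for i
    by (simp flip: M[of i])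
  \<comment> \<open>Injectivity of \<phi> turns the periodicity of angles into periodicity of
    labels.\<close>
  have yper: "y (i + m) = y i" for i
    using inj per yM by (auto simp: inj_on_def)
  have ymod: "y i = y (i mod m)" for i
  proof (induction i rule: less_induct)
    case (less i)
    show ?case
    proof (cases "i < m")
      case False
      then have "y i = y (i - m)" "i mod m = (i - m) mod m"
        using yper[of "i - m"] by (auto simp: le_mod_geq)
      then show ?thesis
        using less[of "i - m"] m False by simp
    qed simp
  qed
  have pair: "{#x i, x (Suc i)#} = M - {#y i#}" for i
    using M[of i, symmetric] by (simp add: add_mset_commute)
  have xper: "{#x i, x (Suc i)#} = {#x (i + m), x (Suc i + m)#}" for i
    using pair[of i] pair[of "i + m"] yper[of i] by simp
  \<comment> \<open>Half a turn preserves each unordered pair \<open>x i\<close>,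
    \<open>x (Suc i)\<close>. If it exchanges the members, then \<open>x (i + 2) = x i\<close>, so
    consecutive pairs coincide and \<open>y\<close> is constant. If it keeps them, the labels
    \<open>x\<close> close up after \<open>m\<close> steps and parity can be used.\<close>
  show ?thesis
  proof (cases "x m = x 0")
    case False
    have alt: "x (i + m) \<noteq> x i" for i
    proof (induction i)
      case (Suc i)
      then show ?case
        using xper[of i] by (auto simp: add_eq_conv_ex)
    qed (use False in simp)
    have sw: "x (i + m) = x (Suc i)" "x (Suc i + m) = x i" for i
      using xper[of i] alt[of i] by (auto simp: add_eq_conv_ex)
    have "y (Suc i) = y i" for i
    proof -
      have "{#x (Suc i), x (Suc (Suc i))#} = {#x i, x (Suc i)#}"
        using sw(1)[of "Suc i"] sw(2)[of i] by (simp add: add_mset_commute)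
      then show ?thesis
        using M[of i] M[of "Suc i"] by (auto simp: mset_triple_eq_iff add_eq_conv_ex)
    qed
    then have "y i = y 0" for i
      by (induction i) simp_all
    then show ?thesis
      by blast
  next
    case True
    define cnt where "cnt k = card {i. i < m \<and> y i = k}" for k
    \<comment> \<open>Double counting of the label \<open>k\<close> over \<open>m\<close> triangles:
      each edge at the vertex belongs to two of them, so modulo 2 only the opposite edges
      count.\<close>
    have even: "even (m * count M k + cnt k)" for k
    proof -
      have "m * count M k = (\<Sum>i<m. count {#x i, x (Suc i), y i#} k)"
        by (simp add: M)
      also have "\<dots> = (\<Sum>i<m. of_bool (x i = k)) + (\<Sum>i<m. of_bool (x (Suc i) = k))
          + (\<Sum>i<m. of_bool (y i = k))"
        unfolding sum.distrib[symmetric] by (intro sum.cong) auto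
      also have "(\<Sum>i<m. of_bool (x (Suc i) = k)) = (\<Sum>i<m. of_bool (x i = k) :: nat)"
      proof -
        have "(\<Sum>i<m. of_bool (x (Suc i) = k)) + of_bool (x 0 = k)
            = (\<Sum>i<m. of_bool (x i = k)) + (of_bool (x m = k) :: nat)"
          by (induction m) simp_all
        then show ?thesis
          using True by simp
      qed
      also have "(\<Sum>i<m. of_bool (y i = k)) = cnt k"
        unfolding cnt_def by (simp add: sum_of_bool_eq Int_def)
      finally show ?thesis
        by simp
    qed
    have tot: "s = (\<Sum>k\<in>set_mset M. cnt k * \<phi> k)"
    proof -
      have "s = (\<Sum>k\<in>set_mset M. \<Sum>i\<in>{i. i \<in> {..<m} \<and> y i = k}. \<phi> (y i))"
        unfolding total[symmetric] using yM by (intro sum.group[symmetric]) auto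
      also have "\<dots> = (\<Sum>k\<in>set_mset M. cnt k * \<phi> k)"
        unfolding cnt_def by (intro sum.cong) auto
      finally show ?thesis .
    qed
    have cnt_pos: "0 < cnt (y i)" for i
    proof -
      have "i mod m \<in> {j. j < m \<and> y j = y i}"
        using m ymod[of i] by simp
      then show ?thesis
        unfolding cnt_def by (subst card_gt_0_iff) auto
    qed
    \<comment> \<open>A lower bound for the multiplicities among the \<open>y i\<close> gives a
      lower bound for the angle total \<open>s\<close>.\<close>
    have bound: "(\<Sum>k\<in>set_mset M. l k * \<phi> k) \<le> s" if "\<And>k. k \<in># M \<Longrightarrow> l k \<le> cnt k" for l :: "real \<Rightarrow> nat"
      unfolding tot using that pos by (intro sum_mono mult_right_mono) (auto intro: less_imp_le)
    show ?thesis
    proof (cases "\<forall>i. y i = y 0")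
      case False
      then obtain j where j: "y j \<noteq> y 0"
        by blast
      define p q where pq: "p = y 0" "q = y j"
      have pq': "p \<noteq> q" "p \<in># M" "q \<in># M" "0 < cnt p" "0 < cnt q"
        using j yM cnt_pos by (auto simp: pq)
      have "size M = 3"
        using M[of 0] by (metis numeral_3_eq_3 size_add_mset size_empty)
      obtain r where r: "M = {#p, q, r#}"
      proof -
        obtain M' where M': "M = add_mset p M'"
          using pq'(2) by (metis insert_DiffM)
        then have "q \<in># M'"
          using pq' by auto
        then obtain M'' where "M' = add_mset q M''"
          by (metis insert_DiffM)
        moreover from this obtain r where "M'' = {#r#}"
          using M' \<open>size M = 3\<close> by simp (metis One_nat_def size_1_singleton_mset)
        ultimately show ?thesis
          using that M' by blast
      qed
      have rest: "cnt r = 0" "r \<noteq> p" "r \<noteq> q"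
      proof -
        \<comment> \<open>If all of \<open>M\<close> occurred among the \<open>y i\<close> with
          multiplicity, the whole angle sum of a triangle would fit into \<open>s\<close>.\<close>
        have False if "\<And>k. k \<in># M \<Longrightarrow> count M k \<le> cnt k"
        proof -
          have "(\<Sum>k\<in>#M. \<phi> k) = (\<Sum>k\<in>set_mset M. count M k * \<phi> k)"
            using pq'(1) by (cases "r = p"; cases "r = q") (auto simp: r insert_commute[of q p])
          then show False
            using bound[of "count M"] that large by simp
        qed note * = this
        show "r \<noteq> p"
        proof
          assume "r = p"
          then have "even (cnt p)"
            using even[of p] r pq'(1) by simp
          then have two: "2 \<le> cnt p"
            using pq'(4) by (cases "cnt p = 1") auto
          show False
            by (rule *) (use two r \<open>r = p\<close> pq' in auto)
        qed
        moreover show "r \<noteq> q"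
        proof
          assume "r = q"
          then have "even (cnt q)"
            using even[of q] r pq'(1) by simp
          then have two: "2 \<le> cnt q"
            using pq'(5) by (cases "cnt q = 1") auto
          show False
            by (rule *) (use two r \<open>r = q\<close> pq' in auto)
        qed
        ultimately have neq: "r \<noteq> p" "r \<noteq> q"
          by blast+
        show "cnt r = 0"
        proof (rule ccontr)
          assume "cnt r \<noteq> 0"
          show False
            by (rule *) (use \<open>cnt r \<noteq> 0\<close> r neq pq' in auto)
        qed
      qed
      \<comment> \<open>Since \<open>r\<close> occurs once in \<open>M\<close> and never among the
        \<open>y i\<close>, parity for \<open>r\<close> makes \<open>m\<close> even; parity for
        \<open>p\<close> and \<open>q\<close> then makes their positive counts even, hence at least
        2.\<close>
      have "even m"
        using even[of r] rest r by simp
      then have "even (cnt p)" "even (cnt q)"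
        using even[of p] even[of q] by auto
      then have ge2: "2 \<le> cnt p" "2 \<le> cnt q"
        using pq'(4,5) by (cases "cnt p = 1"; cases "cnt q = 1"; auto)+
      have "(\<Sum>k\<in>set_mset M. (if k = r then 0 else 2 :: nat) * \<phi> k) \<le> s"
        using ge2 r by (intro bound) auto
      then have "2 * \<phi> p + 2 * \<phi> q \<le> s"
        using rest pq'(1) by (simp add: r)
      moreover have "y i \<in> {p, q}" for i
        using yM[of i] cnt_pos[of i] rest r by auto
      ultimately show ?thesis
        using r by blast
    qed simp
  qed
qed

section \<open>Arrangements with congruent simplicial chambers\<close>

text \<open>The product says that \<open>x\<close> and \<open>y\<close> lie strictly on the same
  side of every plane. For \<open>x\<close> on a plane the set is empty, so
  \<open>x \<in> cell N x\<close> expresses that \<open>x\<close> avoids all planes.\<close>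

definition cell :: "'a::real_inner set \<Rightarrow> 'a \<Rightarrow> 'a set" where
  "cell N x = {y. \<forall>n\<in>N. 0 < (n \<bullet> x) * (n \<bullet> y)}"

definition chamber :: "'a::real_inner set \<Rightarrow> 'a set \<Rightarrow> bool" where
  "chamber N C \<longleftrightarrow> (\<exists>x. x \<in> cell N x \<and> C = cell N x)"

lemma self_in_cell_iff: "x \<in> cell N x \<longleftrightarrow> (\<forall>n\<in>N. n \<bullet> x \<noteq> 0)"
  by (auto simp: cell_def zero_less_mult_iff)

lemma cell_eq:
  assumes "y \<in> cell N x"
  shows "cell N y = cell N x"
  using assms unfolding cell_def zero_less_mult_iff by (auto; metis less_asym)

lemma cell_self: "y \<in> cell N x \<Longrightarrow> y \<in> cell N y"
  using cell_eq by blast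

lemma chamber_eq_cell:
  assumes "chamber N C" "x \<in> C"
  shows "C = cell N x" "x \<in> cell N x"
  using assms cell_eq cell_self unfolding chamber_def by blast+

text \<open>Each plane is represented by both of its unit normals; this makes closedness under
  reflections a statement about a finite set of vectors, free of choices of sign.\<close>

locale unit_normals =
  fixes N :: "(real^3) set"
  assumes finite_N: "finite N"
    and norm_N: "n \<in> N \<Longrightarrow> norm n = 1"
    and uminus_N: "n \<in> N \<Longrightarrow> - n \<in> N"

text \<open>The multiset \<open>M\<close> is all that is retained of the congruence of the
  regions.\<close>

locale congruent_simplicial = unit_normals +
  fixes M :: "real multiset"
  assumes simplicial: "x \<in> cell N x \<Longrightarrow> \<exists>a b c. cell N x = ocone a b c \<and>
    norm a = 1 \<and> norm b = 1 \<and> norm c = 1 \<and> det3 a b c \<noteq> 0 \<and> {#b \<bullet> c, a \<bullet> c, a \<bullet> b#} = M"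
begin

definition tri :: "real^3 \<Rightarrow> real^3 \<Rightarrow> real^3 \<Rightarrow> bool" where
  "tri a b c \<longleftrightarrow> norm a = 1 \<and> norm b = 1 \<and> norm c = 1 \<and> det3 a b c \<noteq> 0 \<and>
     {#b \<bullet> c, a \<bullet> c, a \<bullet> b#} = M \<and> chamber N (ocone a b c)"

lemma triD:
  assumes "tri a b c"
  shows "norm a = 1" "norm b = 1" "norm c = 1" "det3 a b c \<noteq> 0"
    "{#b \<bullet> c, a \<bullet> c, a \<bullet> b#} = M" "chamber N (ocone a b c)"
  using assms by (auto simp: tri_def)

lemma tri_swap: "tri a b c \<Longrightarrow> tri b a c" "tri a b c \<Longrightarrow> tri a c b"
  unfolding tri_def
  by (auto simp: ocone_swap[of b a c] ocone_swap(2)[of a c b] det3_eq_0_iff_swap[of b a c]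
      det3_eq_0_iff_swap(2)[of a c b] inner_commute add_mset_commute)

lemma cell_is_tri:
  assumes "x \<in> cell N x"
  obtains a b c where "tri a b c" "x \<in> ocone a b c"
proof -
  obtain a b c where "cell N x = ocone a b c" "norm a = 1" "norm b = 1" "norm c = 1"
    "det3 a b c \<noteq> 0" "{#b \<bullet> c, a \<bullet> c, a \<bullet> b#} = M"
    using simplicial[OF assms] by blast
  moreover from this have "chamber N (ocone a b c)"
    using assms unfolding chamber_def by metis
  ultimately show ?thesis
    using assms by (intro that[of a b c]) (auto simp: tri_def)
qed

text \<open>The normal is turned towards the chamber; weak positivity passes to the edges, which are
  limits of directions inside the cone.\<close>

lemma tri_sign:
  assumes T: "tri a b c" and n: "n \<in> N"
  obtains m where "m \<in> N" "m = n \<or> m = - n" "0 \<le> m \<bullet> a" "0 \<le> m \<bullet> b" "0 \<le> m \<bullet> c"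
    "\<And>y. y \<in> ocone a b c \<Longrightarrow> 0 < m \<bullet> y"
proof -
  define x where "x = 1 *\<^sub>R a + 1 *\<^sub>R b + 1 *\<^sub>R c"
  have x: "x \<in> ocone a b c"
    unfolding x_def by (rule ocone_memI) simp_all
  have C: "ocone a b c = cell N x"
    using chamber_eq_cell[OF triD(6)[OF T] x] by simp
  define m where "m = (if 0 < n \<bullet> x then n else - n)"
  have m: "m \<in> N" "m = n \<or> m = - n"
    using n uminus_N by (auto simp: m_def)
  have pos: "0 < m \<bullet> y" if "y \<in> ocone a b c" for y
    using that x n unfolding C cell_def m_def by (auto simp: zero_less_mult_iff)
  \<comment> \<open>A negative slope \<open>k\<close> would make the affine function negative or
    zero at the exhibited \<alpha>.\<close>
  have nonneg: "0 \<le> k" if "\<And>\<alpha>. 0 < \<alpha> \<Longrightarrow> 0 < \<alpha> * k + l" for k l :: real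
  proof (rule ccontr)
    assume "\<not> 0 \<le> k"
    then have k: "k < 0"
      by simp
    then have "0 < (\<bar>l\<bar> + 1) / (- k)"
      by (intro divide_pos_pos) auto
    from that[OF this] show False
      using k by simp
  qed
  have "0 \<le> m \<bullet> a"
  proof (rule nonneg)
    fix \<alpha> :: real assume "0 < \<alpha>"
    then have "\<alpha> *\<^sub>R a + 1 *\<^sub>R b + 1 *\<^sub>R c \<in> ocone a b c"
      by (intro ocone_memI) simp_all
    from pos[OF this] show "0 < \<alpha> * (m \<bullet> a) + (m \<bullet> b + m \<bullet> c)"
      by (simp add: inner_add_right add_ac)
  qed
  moreover have "0 \<le> m \<bullet> b"
  proof (rule nonneg)
    fix \<alpha> :: real assume "0 < \<alpha>"
    then have "1 *\<^sub>R a + \<alpha> *\<^sub>R b + 1 *\<^sub>R c \<in> ocone a b c"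
      by (intro ocone_memI) simp_all
    from pos[OF this] show "0 < \<alpha> * (m \<bullet> b) + (m \<bullet> a + m \<bullet> c)"
      by (simp add: inner_add_right add_ac)
  qed
  moreover have "0 \<le> m \<bullet> c"
  proof (rule nonneg)
    fix \<alpha> :: real assume "0 < \<alpha>"
    then have "1 *\<^sub>R a + 1 *\<^sub>R b + \<alpha> *\<^sub>R c \<in> ocone a b c"
      by (intro ocone_memI) simp_all
    from pos[OF this] show "0 < \<alpha> * (m \<bullet> c) + (m \<bullet> a + m \<bullet> b)"
      by (simp add: inner_add_right add_ac)
  qed
  ultimately show ?thesis
    using that m pos by blast
qed

text \<open>If every normal were nonzero on \<open>a\<close> or on \<open>b\<close>, then
  \<open>a + b\<close> would be strictly on the inner side of all planes, hence in the open cone,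
  although its third coordinate is 0.\<close>

lemma tri_wall:
  assumes T: "tri a b c"
  obtains n where "n \<in> N" "n \<bullet> a = 0" "n \<bullet> b = 0" "0 < n \<bullet> c"
proof -
  have "\<exists>n\<in>N. n \<bullet> a = 0 \<and> n \<bullet> b = 0"
  proof (rule ccontr)
    assume neg: "\<not> ?thesis"
    define x where "x = 1 *\<^sub>R a + 1 *\<^sub>R b + 1 *\<^sub>R c"
    have x: "x \<in> ocone a b c"
      unfolding x_def by (rule ocone_memI) simp_all
    have "a + b \<in> cell N x"
      unfolding cell_def
    proof (intro CollectI ballI)
      fix n assume n: "n \<in> N"
      obtain m where m: "m \<in> N" "m = n \<or> m = - n" "0 \<le> m \<bullet> a" "0 \<le> m \<bullet> b" "0 < m \<bullet> x"
        using tri_sign[OF T n] x by metis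
      then have "0 < m \<bullet> a \<or> 0 < m \<bullet> b"
        using neg by force
      then have "0 < m \<bullet> (a + b)"
        using m by (auto simp: inner_add_right)
      then have "0 < (m \<bullet> x) * (m \<bullet> (a + b))"
        using m by (intro mult_pos_pos)
      then show "0 < (n \<bullet> x) * (n \<bullet> (a + b))"
        using m(2) by auto
    qed
    then have "1 *\<^sub>R a + 1 *\<^sub>R b + 0 *\<^sub>R c \<in> ocone a b c"
      using chamber_eq_cell(1)[OF triD(6)[OF T] x] by simp
    then show False
      using ocone_mem_iff[OF triD(4)[OF T], of 1 1 0] by simp
  qed
  then obtain n where n: "n \<in> N" "n \<bullet> a = 0" "n \<bullet> b = 0"
    by blast
  have "n \<bullet> c \<noteq> 0"
    using det3_orthogonal_eq_0[OF triD(4)[OF T] n(2,3)] norm_N[OF n(1)] by auto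
  moreover obtain m where "m \<in> N" "m = n \<or> m = - n" "0 \<le> m \<bullet> c"
    using tri_sign[OF T n(1)] by metis
  ultimately show ?thesis
    using n by (intro that[of m]) auto
qed

text \<open>Weak inequalities describe the closed cone: \<open>y + \<delta> *\<^sub>R x\<close> lies
  in the open chamber for each \<delta> > 0, and its positive coordinates tend to those of
  \<open>y\<close>.\<close>

lemma tri_closed_cone:
  assumes T: "tri a b c" and x: "x \<in> ocone a b c"
    and y: "\<And>n. n \<in> N \<Longrightarrow> 0 \<le> (n \<bullet> x) * (n \<bullet> y)"
  obtains \<alpha> \<beta> \<gamma> where "0 \<le> \<alpha>" "0 \<le> \<beta>" "0 \<le> \<gamma>" "y = \<alpha> *\<^sub>R a + \<beta> *\<^sub>R b + \<gamma> *\<^sub>R c"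
proof -
  note C = chamber_eq_cell[OF triD(6)[OF T] x]
  obtain \<alpha> \<beta> \<gamma> where yc: "y = \<alpha> *\<^sub>R a + \<beta> *\<^sub>R b + \<gamma> *\<^sub>R c"
    by (rule det3_coordinates[OF triD(4)[OF T]])
  obtain \<alpha>' \<beta>' \<gamma>' where xc: "x = \<alpha>' *\<^sub>R a + \<beta>' *\<^sub>R b + \<gamma>' *\<^sub>R c"
    by (rule det3_coordinates[OF triD(4)[OF T]])
  have pos: "0 < \<alpha> + \<delta> * \<alpha>' \<and> 0 < \<beta> + \<delta> * \<beta>' \<and> 0 < \<gamma> + \<delta> * \<gamma>'" if d: "0 < \<delta>" for \<delta>
  proof -
    have "y + \<delta> *\<^sub>R x \<in> cell N x"
      unfolding cell_def
    proof (intro CollectI ballI)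
      fix n assume n: "n \<in> N"
      have "0 < (n \<bullet> x) * (n \<bullet> x)"
        using C(2) n by (auto simp: cell_def)
      then have "0 < (n \<bullet> x) * (n \<bullet> y) + \<delta> * ((n \<bullet> x) * (n \<bullet> x))"
        using add_nonneg_pos[OF y[OF n] mult_pos_pos[OF d]] by blast
      then show "0 < (n \<bullet> x) * (n \<bullet> (y + \<delta> *\<^sub>R x))"
        by (simp add: inner_add_right algebra_simps)
    qed
    then have "y + \<delta> *\<^sub>R x \<in> ocone a b c"
      using C by simp
    also have "y + \<delta> *\<^sub>R x = (\<alpha> + \<delta> * \<alpha>') *\<^sub>R a + (\<beta> + \<delta> * \<beta>') *\<^sub>R b + (\<gamma> + \<delta> * \<gamma>') *\<^sub>R c"
      unfolding xc yc by (simp add: algebra_simps)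
    finally show ?thesis
      by (simp add: ocone_mem_iff[OF triD(4)[OF T]])
  qed
  have nonneg: "0 \<le> k" if "\<And>\<delta>. 0 < \<delta> \<Longrightarrow> 0 < k + \<delta> * l" for k l :: real
  proof (rule ccontr)
    assume k: "\<not> 0 \<le> k"
    have "0 < (- k) / (\<bar>l\<bar> + 1)"
      using k by (intro divide_pos_pos) auto
    from that[OF this] have "- k < (- k) / (\<bar>l\<bar> + 1) * l"
      by simp
    also have "\<dots> \<le> (- k) / (\<bar>l\<bar> + 1) * (\<bar>l\<bar> + 1)"
      using \<open>0 < (- k) / (\<bar>l\<bar> + 1)\<close> by (intro mult_left_mono) auto
    also have "\<dots> = - k"
      by (simp add: add_nonneg_pos)
    finally show False
      by simp
  qed
  show ?thesis
    using pos nonneg yc by (intro that[of \<alpha> \<beta> \<gamma>]) blast+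
qed

end

section \<open>Chambers around a vertex\<close>

definition orthonormal3 :: "real^3 \<Rightarrow> real^3 \<Rightarrow> real^3 \<Rightarrow> bool" where
  "orthonormal3 v p q \<longleftrightarrow> v \<bullet> v = 1 \<and> p \<bullet> p = 1 \<and> q \<bullet> q = 1 \<and> v \<bullet> p = 0 \<and> v \<bullet> q = 0 \<and> p \<bullet> q = 0"

lemma orthonormal3_det3: "orthonormal3 v p q \<Longrightarrow> det3 v p q \<noteq> 0"
  using det3_square[of v p q] by (auto simp: orthonormal3_def)

lemma orthonormal3_expand:
  assumes "orthonormal3 v p q"
  shows "y = (y \<bullet> v) *\<^sub>R v + (y \<bullet> p) *\<^sub>R p + (y \<bullet> q) *\<^sub>R q"
proof -
  have c: "v \<bullet> v = 1" "p \<bullet> p = 1" "q \<bullet> q = 1" "v \<bullet> p = 0" "v \<bullet> q = 0" "p \<bullet> q = 0"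
    "p \<bullet> v = 0" "q \<bullet> v = 0" "q \<bullet> p = 0"
    using assms by (auto simp: orthonormal3_def inner_commute)
  have "y - ((y \<bullet> v) *\<^sub>R v + (y \<bullet> p) *\<^sub>R p + (y \<bullet> q) *\<^sub>R q) = 0"
    by (rule det3_orthogonal_eq_0[OF orthonormal3_det3[OF assms]])
      (simp_all add: c inner_diff_left inner_add_left)
  then show ?thesis
    by simp
qed

definition circ :: "real^3 \<Rightarrow> real^3 \<Rightarrow> real \<Rightarrow> real^3" where
  "circ p q t = cos t *\<^sub>R p + sin t *\<^sub>R q"

lemma inner_circ: "n \<bullet> circ p q t = cos t * (n \<bullet> p) + sin t * (n \<bullet> q)"
  by (simp add: circ_def inner_add_right)

lemma circ_add_pi: "circ p q (t + pi) = - circ p q t"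
  by (simp add: circ_def)

lemma inner_circ_circ:
  assumes "orthonormal3 v p q"
  shows "circ p q s \<bullet> circ p q t = cos (t - s)"
  using assms by (simp add: inner_circ inner_commute[of "circ p q s"] orthonormal3_def cos_diff inner_commute[of q p] mult.commute)

lemma inner_circ_left:
  assumes "orthonormal3 v p q"
  shows "v \<bullet> circ p q t = 0"
  using assms by (simp add: inner_circ orthonormal3_def)

lemma circ_zeros:
  fixes A B s t :: real
  assumes "cos s * A + sin s * B = 0" "cos t * A + sin t * B = 0" "sin (t - s) \<noteq> 0"
  shows "A = 0" "B = 0"
proof -
  have 1: "sin (t - s) * A = sin t * (cos s * A + sin s * B) - sin s * (cos t * A + sin t * B)"
    by (simp add: sin_diff algebra_simps)
  have 2: "sin (t - s) * B = cos s * (cos t * A + sin t * B) - cos t * (cos s * A + sin s * B)"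
    by (simp add: sin_diff algebra_simps)
  show "A = 0" "B = 0"
    using 1[unfolded assms(1,2)] 2[unfolded assms(1,2)] assms(3) by simp_all
qed

text \<open>The half-plane through \<open>d\<close> bounded by the line of \<open>v\<close>. It
  records the direction of an edge at the vertex \<open>v\<close> independently of the length of
  that edge.\<close>

definition halfplane :: "real^3 \<Rightarrow> real^3 \<Rightarrow> (real^3) set" where
  "halfplane v d = {\<alpha> *\<^sub>R v + \<beta> *\<^sub>R d |\<alpha> \<beta>. 0 < \<beta>}"

text \<open>Planes through \<open>v\<close>, read as angles on the unit circle orthogonal to
  \<open>v\<close>. Angles are real numbers, not classes modulo a turn, so that they can be ordered
  along a walk.\<close>

definition plane_dirs :: "(real^3) set \<Rightarrow> real^3 \<Rightarrow> real^3 \<Rightarrow> real^3 \<Rightarrow> real set" where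
  "plane_dirs N v p q = {t. \<exists>n\<in>N. n \<bullet> v = 0 \<and> n \<bullet> circ p q t = 0}"

lemma plane_dirs_add_pi: "t + pi \<in> plane_dirs N v p q \<longleftrightarrow> t \<in> plane_dirs N v p q"
  by (simp add: plane_dirs_def circ_add_pi)

lemma circ_sign_change:
  assumes "s < t" "(n \<bullet> circ p q s) * (n \<bullet> circ p q t) < 0"
  obtains r where "s < r" "r < t" "n \<bullet> circ p q r = 0"
proof -
  have cont: "continuous_on {s..t} (\<lambda>r. n \<bullet> circ p q r)"
    unfolding inner_circ by (intro continuous_intros)
  have "\<exists>r\<ge>s. r \<le> t \<and> n \<bullet> circ p q r = 0"
  proof (cases "n \<bullet> circ p q s \<le> 0")
    case True
    then show ?thesis
      using assms by (intro IVT'[OF _ _ _ cont]) (auto simp: mult_less_0_iff)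
  next
    case False
    then show ?thesis
      using assms by (intro IVT2'[OF _ _ _ cont]) (auto simp: mult_less_0_iff)
  qed
  then obtain r where "s \<le> r" "r \<le> t" "n \<bullet> circ p q r = 0"
    by blast
  moreover from this have "r \<noteq> s" "r \<noteq> t"
    using assms by auto
  ultimately show ?thesis
    by (intro that[of r]) auto
qed

text \<open>Two different planes through \<open>v\<close> meet in the line of
  \<open>v\<close>.\<close>

lemma orthogonal_two_planes:
  assumes on: "orthonormal3 v p q" and "sin (t - s) \<noteq> 0"
    and n: "n \<noteq> 0" "n \<bullet> v = 0" "n \<bullet> circ p q s = 0"
    and m: "m \<noteq> 0" "m \<bullet> v = 0" "m \<bullet> circ p q t = 0"
    and y: "n \<bullet> y = 0" "m \<bullet> y = 0"
  shows "y = (y \<bullet> v) *\<^sub>R v"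
proof -
  have key: "cos s * (y \<bullet> q) + sin s * (- (y \<bullet> p)) = 0"
    if n: "n \<noteq> 0" "n \<bullet> v = 0" "n \<bullet> circ p q s = 0" "n \<bullet> y = 0" for n s
  proof -
    \<comment> \<open>In the frame, \<open>n\<close> is \<open>k\<close> times the circle direction
      at angle s + pi / 2; hence the condition on \<open>y\<close> is one linear equation depending
      on \<open>s\<close> only.\<close>
    define k where "k = cos s * (n \<bullet> q) - sin s * (n \<bullet> p)"
    have c: "cos s * (n \<bullet> p) + sin s * (n \<bullet> q) = 0"
      using n(3) by (simp add: inner_circ)
    have sc: "(sin s)\<^sup>2 + (cos s)\<^sup>2 = 1"
      by simp
    have np: "n \<bullet> p = - sin s * k" and nq: "n \<bullet> q = cos s * k"
      using c sc unfolding k_def by algebra+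
    have "k \<noteq> 0"
    proof
      assume "k = 0"
      then have "n = 0"
        using np nq n by (intro det3_orthogonal_eq_0[OF orthonormal3_det3[OF on]]) auto
      then show False
        using n by simp
    qed
    have "n \<bullet> y = (n \<bullet> p) * (y \<bullet> p) + (n \<bullet> q) * (y \<bullet> q)"
      using arg_cong[OF orthonormal3_expand[OF on, of y], of "\<lambda>z. n \<bullet> z"] n(2)
      by (simp add: inner_add_right mult.commute)
    then have "k * (cos s * (y \<bullet> q) + sin s * (- (y \<bullet> p))) = 0"
      using n(4) by (auto simp: np nq algebra_simps)
    then show ?thesis
      using \<open>k \<noteq> 0\<close> by simp
  qed
  have "y \<bullet> q = 0" "- (y \<bullet> p) = 0"
    using circ_zeros[OF key[OF n y(1)] key[OF m y(2)] assms(2)] by blast+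
  then show ?thesis
    by (subst orthonormal3_expand[OF on, of y]) simp
qed

text \<open>A step from \<open>v\<close> of length \<epsilon> crosses no plane that avoids
  \<open>v\<close>. The inserted 1 keeps the minimum defined, and halving it gives
  strictness.\<close>

lemma (in unit_normals) vertex_margin:
  obtains \<epsilon> where "0 < \<epsilon>" "\<And>n. n \<in> N \<Longrightarrow> n \<bullet> v \<noteq> 0 \<Longrightarrow> \<epsilon> < \<bar>n \<bullet> v\<bar>"
proof
  let ?S = "insert 1 ((\<lambda>n. \<bar>n \<bullet> v\<bar>) ` {n \<in> N. n \<bullet> v \<noteq> 0})"
  have fin: "finite ?S"
    using finite_N by simp
  have "0 < Min ?S"
    using fin by (subst Min_gr_iff) auto
  then show "0 < Min ?S / 2"
    by simp
  show "Min ?S / 2 < \<bar>n \<bullet> v\<bar>" if "n \<in> N" "n \<bullet> v \<noteq> 0" for n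
  proof -
    have "Min ?S \<le> \<bar>n \<bullet> v\<bar>"
      using fin that by (intro Min_le) auto
    then show ?thesis
      using \<open>0 < Min ?S\<close> by linarith
  qed
qed

context congruent_simplicial
begin

text \<open>The chamber sought is the one containing \<open>z h\<close>, a point close to
  \<open>v\<close> in the middle direction. The points \<open>v\<close>, \<open>z s\<close> and
  \<open>z t\<close> lie in its closure: planes avoiding \<open>v\<close> are too far away, and
  planes through \<open>v\<close> have no direction strictly between \<open>s\<close> and
  \<open>t\<close>.\<close>

lemma sector_tri:
  assumes on: "orthonormal3 v p q"
    and T: "s \<in> plane_dirs N v p q" "t \<in> plane_dirs N v p q"
    and st: "s < t" "t < s + pi"
    and gap: "\<And>r. s < r \<Longrightarrow> r < t \<Longrightarrow> r \<notin> plane_dirs N v p q"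
  obtains e f where "tri v e f" "e \<in> halfplane v (circ p q s)" "f \<in> halfplane v (circ p q t)"
proof -
  let ?u = "circ p q"
  obtain ns where ns: "ns \<in> N" "ns \<bullet> v = 0" "ns \<bullet> ?u s = 0"
    using T unfolding plane_dirs_def by blast
  obtain nt where nt: "nt \<in> N" "nt \<bullet> v = 0" "nt \<bullet> ?u t = 0"
    using T unfolding plane_dirs_def by blast
  have nz: "ns \<noteq> 0" "nt \<noteq> 0"
    using norm_N[OF ns(1)] norm_N[OF nt(1)] by auto
  have sin: "sin (t - s) \<noteq> 0"
    using sin_gt_zero[of "t - s"] st by simp
  have v1: "norm v = 1"
    using on by (simp add: orthonormal3_def norm_eq_1)
  have unorm: "norm (?u r) = 1" for r
    using inner_circ_circ[OF on, of r r] by (simp add: norm_eq_1)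
  obtain \<epsilon> where eps: "0 < \<epsilon>" "\<And>n. n \<in> N \<Longrightarrow> n \<bullet> v \<noteq> 0 \<Longrightarrow> \<epsilon> < \<bar>n \<bullet> v\<bar>"
    using vertex_margin[of v] by metis
  define z where "z r = v + \<epsilon> *\<^sub>R ?u r" for r
  define h where "h = (s + t) / 2"
  have h: "s < h" "h < t"
    using st by (auto simp: h_def)
  have zn: "n \<bullet> z r = n \<bullet> v + \<epsilon> * (n \<bullet> ?u r)" for n r
    by (simp add: z_def inner_add_right)
  have small: "\<bar>\<epsilon> * (n \<bullet> ?u r)\<bar> \<le> \<epsilon>" if "n \<in> N" for n r
  proof -
    have "\<bar>n \<bullet> ?u r\<bar> \<le> 1"
      using Cauchy_Schwarz_ineq2[of n "?u r"] norm_N[OF that] unorm by simp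
    then show ?thesis
      using eps(1) by (simp add: abs_mult)
  qed
  have far: "0 < (n \<bullet> z h) * (n \<bullet> z r) \<and> 0 < (n \<bullet> z h) * (n \<bullet> v)" if "n \<in> N" "n \<bullet> v \<noteq> 0" for n r
    unfolding zn using eps(2)[OF that] small[OF that(1), of h] small[OF that(1), of r]
    by (auto simp: zero_less_mult_iff)
  have near: "0 \<le> (n \<bullet> ?u h) * (n \<bullet> ?u r)" if "n \<in> N" "n \<bullet> v = 0" "s \<le> r" "r \<le> t" for n r
  proof (rule ccontr)
    assume neg: "\<not> ?thesis"
    then have "r \<noteq> h"
      by auto
    then consider "r < h" | "h < r"
      by linarith
    then show False
    proof cases
      case 1
      then obtain r' where "r < r'" "r' < h" "n \<bullet> ?u r' = 0"
        using circ_sign_change[of r h n p q] neg by (auto simp: mult.commute)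
      then show False
        using gap[of r'] that h unfolding plane_dirs_def by auto
    next
      case 2
      then obtain r' where "h < r'" "r' < r" "n \<bullet> ?u r' = 0"
        using circ_sign_change[of h r n p q] neg by auto
      then show False
        using gap[of r'] that h unfolding plane_dirs_def by auto
    qed
  qed
  have clo: "0 \<le> (n \<bullet> z h) * (n \<bullet> z r)" if "n \<in> N" "s \<le> r" "r \<le> t" for n r
  proof (cases "n \<bullet> v = 0")
    case True
    have "(n \<bullet> z h) * (n \<bullet> z r) = \<epsilon> * \<epsilon> * ((n \<bullet> ?u h) * (n \<bullet> ?u r))"
      by (simp add: zn True)
    then show ?thesis
      using near[OF that(1) True that(2,3)] eps(1) by simp
  qed (use far that in \<open>auto intro: less_imp_le\<close>)
  have gen: "z h \<in> cell N (z h)"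
    unfolding self_in_cell_iff
  proof
    fix n assume n: "n \<in> N"
    show "n \<bullet> z h \<noteq> 0"
    proof (cases "n \<bullet> v = 0")
      case True
      then show ?thesis
        using gap[OF h] n eps(1) by (auto simp: plane_dirs_def zn)
    qed (use far[OF n] in force)
  qed
  obtain a0 b0 c0 where T0: "tri a0 b0 c0" "z h \<in> ocone a0 b0 c0"
    using cell_is_tri[OF gen] by metis
  have clo_v: "0 \<le> (n \<bullet> z h) * (n \<bullet> v)" if "n \<in> N" for n
    using far[OF that] by (cases "n \<bullet> v = 0") (auto intro: less_imp_le)
  \<comment> \<open>A vertex with positive weight in \<open>v\<close> lies on every plane through
    \<open>v\<close>, as all terms have one sign. Two such planes confine it to the line of
    \<open>v\<close>, and independence excludes \<open>- v\<close>.\<close>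
  have v_eq: "v = a" if A: "tri a b c" "v = \<alpha> *\<^sub>R a + \<beta> *\<^sub>R b + \<gamma> *\<^sub>R c" "0 < \<alpha>" "0 \<le> \<beta>" "0 \<le> \<gamma>"
    for a b c \<alpha> \<beta> \<gamma>
  proof -
    have "n \<bullet> a = 0" if n: "n \<in> N" "n \<bullet> v = 0" for n
    proof -
      obtain m where m: "m = n \<or> m = - n" "0 \<le> m \<bullet> a" "0 \<le> m \<bullet> b" "0 \<le> m \<bullet> c"
        using tri_sign[OF A(1) n(1)] by metis
      have "0 = m \<bullet> v"
        using m n by auto
      also have "\<dots> = \<alpha> * (m \<bullet> a) + \<beta> * (m \<bullet> b) + \<gamma> * (m \<bullet> c)"
        by (simp add: A(2) inner_add_right)
      finally have "\<alpha> * (m \<bullet> a) = 0"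
        using mult_nonneg_nonneg[of \<alpha> "m \<bullet> a"] mult_nonneg_nonneg[of \<beta> "m \<bullet> b"]
          mult_nonneg_nonneg[of \<gamma> "m \<bullet> c"] m A by linarith
      then show ?thesis
        using A m by auto
    qed
    then have a: "a = (a \<bullet> v) *\<^sub>R v"
      using orthogonal_two_planes[OF on sin nz(1) ns(2,3) nz(2) nt(2,3)] ns nt by blast
    have "norm a = \<bar>a \<bullet> v\<bar> * norm v"
      by (subst a) simp
    then have "a \<bullet> v = 1 \<or> a \<bullet> v = - 1"
      using triD(1)[OF A(1)] v1 by auto
    moreover have "a \<bullet> v \<noteq> - 1"
    proof
      assume neg: "a \<bullet> v = - 1"
      have av: "a = - v"
        using a unfolding neg by simp
      have "(\<alpha> + 1) *\<^sub>R a + \<beta> *\<^sub>R b + \<gamma> *\<^sub>R c = a + (\<alpha> *\<^sub>R a + \<beta> *\<^sub>R b + \<gamma> *\<^sub>R c)"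
        by (simp add: algebra_simps)
      also have "\<dots> = a + v"
        by (simp only: A(2)[symmetric])
      finally have "(\<alpha> + 1) *\<^sub>R a + \<beta> *\<^sub>R b + \<gamma> *\<^sub>R c = 0"
        by (simp add: av)
      then show False
        using det3_combination_eq_0D(1)[OF triD(4)[OF A(1)]] A by fastforce
    qed
    ultimately have "a \<bullet> v = 1"
      by blast
    then show ?thesis
      using a by simp
  qed
  obtain b c where T1: "tri v b c" "z h \<in> ocone v b c"
  proof -
    obtain \<alpha> \<beta> \<gamma> where c: "0 \<le> \<alpha>" "0 \<le> \<beta>" "0 \<le> \<gamma>" "v = \<alpha> *\<^sub>R a0 + \<beta> *\<^sub>R b0 + \<gamma> *\<^sub>R c0"
      using tri_closed_cone[OF T0 clo_v] by metis
    have "\<not> (\<alpha> = 0 \<and> \<beta> = 0 \<and> \<gamma> = 0)"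
      using c v1 by auto
    then consider "0 < \<alpha>" | "0 < \<beta>" | "0 < \<gamma>"
      using c by fastforce
    then show ?thesis
    proof cases
      case 1
      then have "v = a0"
        using v_eq[OF T0(1)] c by blast
      then show ?thesis
        using T0 that by blast
    next
      case 2
      then have "v = b0"
        using v_eq[OF tri_swap(1)[OF T0(1)], of \<beta> \<alpha> \<gamma>] c by (simp add: add_ac)
      then show ?thesis
        using T0 tri_swap(1) that[of a0 c0] ocone_swap by metis
    next
      case 3
      then have "v = c0"
        using v_eq[OF tri_swap(1)[OF tri_swap(2)[OF T0(1)]], of \<gamma> \<alpha> \<beta>] c by (simp add: add_ac)
      then show ?thesis
        using T0 tri_swap that[of a0 b0] ocone_swap by metis
    qed
  qed
  \<comment> \<open>The boundary point \<open>z r\<close> lies on a plane through \<open>v\<close>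
    that supports the chamber and cannot contain both \<open>b\<close> and \<open>c\<close>; so only
    one of them occurs in \<open>z r\<close>, and that one has direction \<open>r\<close>.\<close>
  have side: "b \<in> halfplane v (?u r) \<or> c \<in> halfplane v (?u r)"
    if r: "s \<le> r" "r \<le> t" and n: "n \<in> N" "n \<bullet> v = 0" "n \<bullet> ?u r = 0" for r n
  proof -
    obtain \<alpha> \<beta> \<gamma> where c: "0 \<le> \<beta>" "0 \<le> \<gamma>" "z r = \<alpha> *\<^sub>R v + \<beta> *\<^sub>R b + \<gamma> *\<^sub>R c"
      using tri_closed_cone[OF T1 clo[OF _ r]] by metis
    obtain m where m: "m = n \<or> m = - n" "0 \<le> m \<bullet> b" "0 \<le> m \<bullet> c" "m \<in> N"
      using tri_sign[OF T1(1) n(1)] by metis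
    have mv: "m \<bullet> v = 0" "m \<bullet> z r = 0"
      using m n by (auto simp: zn)
    have "\<beta> * (m \<bullet> b) + \<gamma> * (m \<bullet> c) = 0"
      using mv unfolding c(3) by (simp add: inner_add_right)
    then have zero: "\<beta> * (m \<bullet> b) = 0" "\<gamma> * (m \<bullet> c) = 0"
      using mult_nonneg_nonneg[OF c(1) m(2)] mult_nonneg_nonneg[OF c(2) m(3)] by linarith+
    have "\<not> (m \<bullet> b = 0 \<and> m \<bullet> c = 0)"
      using det3_orthogonal_eq_0[OF triD(4)[OF T1(1)] mv(1)] norm_N[OF m(4)] by auto
    then have or: "\<beta> = 0 \<or> \<gamma> = 0"
      using zero by auto
    have "\<epsilon> *\<^sub>R ?u r = (\<alpha> - 1) *\<^sub>R v + \<beta> *\<^sub>R b + \<gamma> *\<^sub>R c"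
      using c(3) by (simp add: z_def algebra_simps)
    then have ueq: "\<beta> *\<^sub>R b + \<gamma> *\<^sub>R c = (1 - \<alpha>) *\<^sub>R v + \<epsilon> *\<^sub>R ?u r"
      by (simp add: algebra_simps)
    have pos: "0 < \<beta> \<or> 0 < \<gamma>"
    proof (rule ccontr)
      assume "\<not> ?thesis"
      then have "\<beta> = 0" "\<gamma> = 0"
        using c by auto
      then have "?u r \<bullet> ((1 - \<alpha>) *\<^sub>R v + \<epsilon> *\<^sub>R ?u r) = 0"
        using ueq by simp
      then show False
        using inner_circ_left[OF on, of r] inner_circ_circ[OF on, of r r] eps(1)
        by (simp add: inner_add_right inner_commute)
    qed
    have mem: "x \<in> halfplane v (?u r)" if "k *\<^sub>R x = (1 - \<alpha>) *\<^sub>R v + \<epsilon> *\<^sub>R ?u r" "0 < k" for k x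
    proof -
      have "x = (1 / k) *\<^sub>R (k *\<^sub>R x)"
        using that(2) by simp
      also have "\<dots> = ((1 - \<alpha>) / k) *\<^sub>R v + (\<epsilon> / k) *\<^sub>R ?u r"
        unfolding that(1) by (simp add: scaleR_add_right)
      finally show ?thesis
        unfolding halfplane_def using that(2) eps(1) by fastforce
    qed
    show ?thesis
      using pos or ueq mem[of \<beta> b] mem[of \<gamma> c] by auto
  qed
  \<comment> \<open>No vector lies in both half-planes, so \<open>b\<close> and \<open>c\<close> are
    distributed over the two directions.\<close>
  have excl: False if x: "x \<in> halfplane v (?u s)" "x \<in> halfplane v (?u t)" for x
  proof -
    obtain \<alpha> \<beta> where 1: "x = \<alpha> *\<^sub>R v + \<beta> *\<^sub>R ?u s" "0 < \<beta>"
      using x(1) unfolding halfplane_def by blast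
    obtain \<alpha>' \<beta>' where 2: "x = \<alpha>' *\<^sub>R v + \<beta>' *\<^sub>R ?u t" "0 < \<beta>'"
      using x(2) unfolding halfplane_def by blast
    have "ns \<bullet> x = 0" "nt \<bullet> x = 0"
      using ns nt by (simp add: 1 inner_add_right, simp add: 2 inner_add_right)
    then have "x = (x \<bullet> v) *\<^sub>R v"
      by (rule orthogonal_two_planes[OF on sin nz(1) ns(2,3) nz(2) nt(2,3)])
    from arg_cong[OF this, of "\<lambda>y. ?u s \<bullet> y"] have "?u s \<bullet> x = 0"
      using inner_circ_left[OF on, of s] by (simp add: inner_commute)
    then show False
      using inner_circ_left[OF on, of s] inner_circ_circ[OF on, of s s] 1
      by (simp add: inner_add_right inner_commute)
  qed
  have "b \<in> halfplane v (?u s) \<or> c \<in> halfplane v (?u s)" "b \<in> halfplane v (?u t) \<or> c \<in> halfplane v (?u t)"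
    using side[of s ns] side[of t nt] ns nt st by auto
  then consider "b \<in> halfplane v (?u s)" "c \<in> halfplane v (?u t)"
    | "c \<in> halfplane v (?u s)" "b \<in> halfplane v (?u t)"
    using excl by blast
  then show ?thesis
    using that[OF T1(1)] that[OF tri_swap(2)[OF T1(1)]] by cases blast+
qed

text \<open>Otherwise one edge would lie strictly between \<open>v\<close> and the other; the wall
  opposite to \<open>v\<close> in its triangle would then separate \<open>v\<close> from the other
  edge, although these two span an edge of a single chamber.\<close>

lemma halfplane_edge_unique:
  assumes 1: "tri v e f" and 2: "tri v d g"
    and "e \<in> halfplane v u" "d \<in> halfplane v u"
  shows "e = d"
proof -
  have no: False if T1: "tri v e f" and T2: "tri v d g" and k: "0 < \<kappa>" "0 < \<beta>"
    and eq: "\<beta>' *\<^sub>R e = \<kappa> *\<^sub>R v + \<beta> *\<^sub>R d" for e f d g \<kappa> \<beta> \<beta>'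
  proof -
    obtain n where n: "n \<in> N" "n \<bullet> e = 0" "0 < n \<bullet> v"
      using tri_wall[OF tri_swap(2)[OF tri_swap(1)[OF T1]]] by metis
    obtain m where m: "m = n \<or> m = - n" "0 \<le> m \<bullet> v" "0 \<le> m \<bullet> d"
      using tri_sign[OF T2 n(1)] by metis
    then have "m = n"
      using n by auto
    have "0 = n \<bullet> (\<beta>' *\<^sub>R e)"
      using n by simp
    also have "\<dots> = \<kappa> * (n \<bullet> v) + \<beta> * (n \<bullet> d)"
      unfolding eq by (simp add: inner_add_right)
    also have "\<dots> > 0"
      using k n m \<open>m = n\<close> by (intro add_pos_nonneg) auto
    finally show False
      by simp
  qed
  obtain \<alpha> \<beta> where e: "e = \<alpha> *\<^sub>R v + \<beta> *\<^sub>R u" "0 < \<beta>"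
    using assms(3) unfolding halfplane_def by blast
  obtain \<alpha>' \<beta>' where d: "d = \<alpha>' *\<^sub>R v + \<beta>' *\<^sub>R u" "0 < \<beta>'"
    using assms(4) unfolding halfplane_def by blast
  define \<kappa> where "\<kappa> = \<beta>' * \<alpha> - \<beta> * \<alpha>'"
  have eq: "\<beta>' *\<^sub>R e = \<kappa> *\<^sub>R v + \<beta> *\<^sub>R d" "\<beta> *\<^sub>R d = (- \<kappa>) *\<^sub>R v + \<beta>' *\<^sub>R e"
    unfolding e d \<kappa>_def by (simp_all add: algebra_simps)
  have "\<not> 0 < \<kappa>" "\<not> 0 < - \<kappa>"
    using no[OF 1 2 _ e(2) eq(1)] no[OF 2 1 _ d(2) eq(2)] by blast+
  then have "\<kappa> = 0"
    by simp
  then have eq': "\<beta>' *\<^sub>R e = \<beta> *\<^sub>R d"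
    using eq(1) by simp
  moreover have "\<beta>' = \<beta>"
    using arg_cong[OF eq', of norm] triD(2)[OF 1] triD(2)[OF 2] e(2) d(2) by simp
  ultimately show ?thesis
    using e(2) by simp
qed

end

text \<open>Two directions of the same plane in a half-open half turn would be linearly independent,
  forcing its normal to vanish.\<close>

lemma finite_plane_dirs:
  assumes on: "orthonormal3 v p q" and "finite N" "0 \<notin> N"
  shows "finite (plane_dirs N v p q \<inter> {t<..t + pi})"
proof -
  have "plane_dirs N v p q \<inter> {t<..t + pi} \<subseteq>
    (\<Union>n\<in>{n\<in>N. n \<bullet> v = 0}. {r\<in>{t<..t + pi}. n \<bullet> circ p q r = 0})"
    by (auto simp: plane_dirs_def)
  moreover have "finite {r\<in>{t<..t + pi}. n \<bullet> circ p q r = 0}" if n: "n \<in> N" "n \<bullet> v = 0" for n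
  proof -
    have "r = r'" if r: "r \<in> {t<..t + pi}" "n \<bullet> circ p q r = 0" "r' \<in> {t<..t + pi}" "n \<bullet> circ p q r' = 0"
      for r r'
    proof (rule ccontr)
      assume "r \<noteq> r'"
      then have "sin (r' - r) \<noteq> 0"
        using r sin_gt_zero[of "r' - r"] sin_gt_zero[of "r - r'"] sin_minus[of "r - r'"]
        by (cases "r < r'") auto
      then have "n \<bullet> p = 0" "n \<bullet> q = 0"
        using circ_zeros[OF r(2)[unfolded inner_circ] r(4)[unfolded inner_circ]] by blast+
      then have "n = 0"
        using n by (intro det3_orthogonal_eq_0[OF orthonormal3_det3[OF on]])
      then show False
        using n assms by simp
    qed
    then have "{r\<in>{t<..t + pi}. n \<bullet> circ p q r = 0} = {} \<or>
      (\<exists>r. {r\<in>{t<..t + pi}. n \<bullet> circ p q r = 0} = {r})"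
      by blast
    then show ?thesis
      by (elim disjE exE) (simp_all only: finite.emptyI finite.insertI)
  qed
  ultimately show ?thesis
    using assms(2) by (elim finite_subset) auto
qed

text \<open>The strict bounds on the cosines follow from (1 - y^2) (1 - z^2) = D + (x - y z)^2 with
  the Gram determinant D positive.\<close>

lemma spherical_sides_of_unit_vectors:
  assumes "norm a = 1" "norm b = 1" "norm c = 1" "det3 a b c \<noteq> 0"
  shows "spherical_sides (b \<bullet> c) (a \<bullet> c) (a \<bullet> b)"
proof -
  define x y z where xyz: "x = b \<bullet> c" "y = a \<bullet> c" "z = a \<bullet> b"
  have "0 < (det3 a b c)\<^sup>2"
    using assms(4) by simp
  then have D: "0 < 1 - x\<^sup>2 - y\<^sup>2 - z\<^sup>2 + 2 * x * y * z"
    unfolding det3_square xyz using assms by (simp add: norm_eq_1 algebra_simps)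
  have "\<bar>x\<bar> \<le> 1" "\<bar>y\<bar> \<le> 1" "\<bar>z\<bar> \<le> 1"
    unfolding xyz using Cauchy_Schwarz_ineq2 assms by (metis mult_1)+
  then have le: "x\<^sup>2 \<le> 1" "y\<^sup>2 \<le> 1" "z\<^sup>2 \<le> 1"
    by (simp_all add: abs_square_le_1)
  have "(1 - y\<^sup>2) * (1 - z\<^sup>2) = (1 - x\<^sup>2 - y\<^sup>2 - z\<^sup>2 + 2 * x * y * z) + (x - y * z)\<^sup>2"
    "(1 - x\<^sup>2) * (1 - z\<^sup>2) = (1 - x\<^sup>2 - y\<^sup>2 - z\<^sup>2 + 2 * x * y * z) + (y - x * z)\<^sup>2"
    by algebra+
  then have "0 < (1 - y\<^sup>2) * (1 - z\<^sup>2)" "0 < (1 - x\<^sup>2) * (1 - z\<^sup>2)"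
    using D by (simp_all add: add_pos_nonneg)
  then have "x\<^sup>2 \<noteq> 1" "y\<^sup>2 \<noteq> 1" "z\<^sup>2 \<noteq> 1"
    by auto
  then show ?thesis
    using D le unfolding spherical_sides_def xyz by (simp add: less_le)
qed

section \<open>One turn around a vertex\<close>

context congruent_simplicial
begin

lemma adapted_frame:
  assumes T: "tri v e f"
  obtains p q t where "orthonormal3 v p q" "e \<in> halfplane v (circ p q 0)"
    "f \<in> halfplane v (circ p q t)" "0 < t" "t < pi"
proof -
  note u = triD(1-3)[OF T]
  define x where "x = v \<bullet> e"
  have x1: "x\<^sup>2 < 1"
    using spherical_sides_of_unit_vectors[OF triD(1-4)[OF T]] by (simp add: spherical_sides_def x_def)
  have vv: "v \<bullet> v = 1" "e \<bullet> e = 1"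
    using u by (simp_all add: norm_eq_1)
  define \<beta> where "\<beta> = sqrt (1 - x\<^sup>2)"
  have \<beta>: "0 < \<beta>" "\<beta>\<^sup>2 = 1 - x\<^sup>2"
    using x1 by (auto simp: \<beta>_def)
  define p where "p = (1 / \<beta>) *\<^sub>R (e - x *\<^sub>R v)"
  have vp: "v \<bullet> p = 0"
    by (simp add: p_def inner_diff_right vv x_def)
  have "(e - x *\<^sub>R v) \<bullet> (e - x *\<^sub>R v) = 1 - x\<^sup>2"
    by (simp add: inner_diff_left inner_diff_right vv inner_commute x_def power2_eq_square)
  then have pp: "p \<bullet> p = 1"
    using \<beta> by (auto simp: p_def power2_eq_square)
  have e: "e = x *\<^sub>R v + \<beta> *\<^sub>R p"
    using \<beta> by (simp add: p_def)
  define q0 where "q0 = cross3 v p"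
  have q0: "v \<bullet> q0 = 0" "p \<bullet> q0 = 0" "q0 \<bullet> q0 = 1"
    using vv pp vp dot_cross[of v p v p] by (simp_all add: q0_def dot_cross_self inner_commute)
  have "f \<bullet> q0 \<noteq> 0"
  proof
    assume "f \<bullet> q0 = 0"
    then have "q0 = 0"
      using q0 by (intro det3_orthogonal_eq_0[OF triD(4)[OF T]])
        (auto simp: e inner_add_right inner_commute)
    then show False
      using q0 by simp
  qed
  \<comment> \<open>The sign of \<open>q\<close> is chosen so that \<open>f\<close> is at an angle
    between 0 and pi when \<open>e\<close> is at angle 0.\<close>
  define q where "q = (if 0 < f \<bullet> q0 then q0 else - q0)"
  have q: "v \<bullet> q = 0" "p \<bullet> q = 0" "q \<bullet> q = 1" "0 < f \<bullet> q"
    using q0 \<open>f \<bullet> q0 \<noteq> 0\<close> by (auto simp: q_def)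
  have on: "orthonormal3 v p q"
    using vv vp pp q by (simp add: orthonormal3_def)
  define R where "R = sqrt ((f \<bullet> p)\<^sup>2 + (f \<bullet> q)\<^sup>2)"
  have R2: "R\<^sup>2 = (f \<bullet> p)\<^sup>2 + (f \<bullet> q)\<^sup>2"
    by (simp add: R_def)
  have R: "0 < R"
    using q by (simp add: R_def add_nonneg_pos)
  have "((f \<bullet> p) / R)\<^sup>2 + ((f \<bullet> q) / R)\<^sup>2 = 1"
    using R unfolding power_divide add_divide_distrib[symmetric] R2[symmetric] by simp
  then obtain t where t: "0 \<le> t" "t < 2 * pi" "(f \<bullet> p) / R = cos t" "(f \<bullet> q) / R = sin t"
    using sincos_total_2pi by metis
  have "0 < sin t"
    using q(4) R t(4) by (metis divide_pos_pos)
  then have t': "0 < t" "t < pi"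
    using t(1,2) sin_le_zero[of t] by (cases "t = 0"; force)+
  have "f = (f \<bullet> v) *\<^sub>R v + R *\<^sub>R circ p q t"
    using R by (subst orthonormal3_expand[OF on, of f]) (simp add: circ_def scaleR_add_right flip: t(3,4))
  then have "f \<in> halfplane v (circ p q t)"
    unfolding halfplane_def using R by blast
  moreover have "e \<in> halfplane v (circ p q 0)"
    unfolding halfplane_def using e \<beta> by (auto simp: circ_def)
  ultimately show ?thesis
    using that on t' by blast
qed

lemma halfplane_wall_dir:
  assumes "e \<in> halfplane v (circ p q t)" "n \<in> N" "n \<bullet> v = 0" "n \<bullet> e = 0"
  shows "t \<in> plane_dirs N v p q"
  using assms unfolding halfplane_def plane_dirs_def by (auto simp: inner_add_right)

text \<open>The directions are enumerated by passing to the next one. Each gap carries one triangle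
  by \<open>sector_tri\<close>, and consecutive triangles share an edge because an edge is
  determined by its half-plane.\<close>

lemma vertex_cycle:
  assumes T: "tri v e f"
  obtains p q ts w m where "orthonormal3 v p q" "0 < m"
    "\<And>i. tri v (w i) (w (Suc i))" "\<And>i. w i \<in> halfplane v (circ p q (ts i))"
    "\<And>i. ts i < ts (Suc i)" "\<And>i. ts (Suc i) < ts i + pi" "\<And>i. ts (i + m) = ts i + pi"
    "ts m = 0" "w m = e" "w (Suc m) = f"
proof -
  obtain p q t1 where on: "orthonormal3 v p q" and e: "e \<in> halfplane v (circ p q 0)"
    and f: "f \<in> halfplane v (circ p q t1)" and t1: "0 < t1" "t1 < pi"
    using adapted_frame[OF T] by metis
  define D where "D = plane_dirs N v p q"
  have Dpi: "t + pi \<in> D \<longleftrightarrow> t \<in> D" for t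
    by (simp add: D_def plane_dirs_add_pi)
  obtain n0 where n0: "n0 \<in> N" "n0 \<bullet> v = 0" "n0 \<bullet> e = 0" "0 < n0 \<bullet> f"
    using tri_wall[OF T] by metis
  obtain n1 where n1: "n1 \<in> N" "n1 \<bullet> v = 0" "n1 \<bullet> f = 0" "0 < n1 \<bullet> e"
    using tri_wall[OF tri_swap(2)[OF T]] by metis
  have D0: "0 \<in> D" "t1 \<in> D"
    unfolding D_def using halfplane_wall_dir e f n0 n1 by blast+
  \<comment> \<open>A form that is nonnegative at angles 0 and \<open>t1\<close> and zero strictly
    between them vanishes at both, hence identically.\<close>
  have gap0: "r \<notin> D" if r: "0 < r" "r < t1" for r
  proof
    assume "r \<in> D"
    then obtain n where n: "n \<in> N" "n \<bullet> v = 0" "n \<bullet> circ p q r = 0"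
      unfolding D_def plane_dirs_def by blast
    obtain m where m: "m \<in> N" "m = n \<or> m = - n" "0 \<le> m \<bullet> e" "0 \<le> m \<bullet> f"
      using tri_sign[OF T n(1)] by metis
    have m0: "m \<bullet> v = 0" "m \<bullet> circ p q r = 0"
      using m n by auto
    define A B where AB: "A = m \<bullet> p" "B = m \<bullet> q"
    have A: "0 \<le> A"
      using e m(3) m0 unfolding halfplane_def AB
      by (auto simp: circ_def inner_add_right zero_le_mult_iff)
    have B: "0 \<le> cos t1 * A + sin t1 * B"
      using f m(4) m0 unfolding halfplane_def AB
      by (auto simp: inner_add_right zero_le_mult_iff inner_circ)
    have "sin (t1 - r) * A + sin r * (cos t1 * A + sin t1 * B) = sin t1 * (cos r * A + sin r * B)"
      by (simp add: sin_diff algebra_simps)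
    also have "cos r * A + sin r * B = 0"
      using m0(2) by (simp add: inner_circ AB)
    finally have sum0: "sin (t1 - r) * A + sin r * (cos t1 * A + sin t1 * B) = 0"
      by simp
    have pos: "0 < sin (t1 - r)" "0 < sin r" "0 < sin t1"
      using r t1 by (auto intro!: sin_gt_zero)
    have "sin (t1 - r) * A = 0" "sin r * (cos t1 * A + sin t1 * B) = 0"
      using sum0 mult_nonneg_nonneg[of "sin (t1 - r)" A] A pos
        mult_nonneg_nonneg[of "sin r" "cos t1 * A + sin t1 * B"] B by linarith+
    then have "A = 0" "B = 0"
      using pos by auto
    then have "m = 0"
      using m0 AB by (intro det3_orthogonal_eq_0[OF orthonormal3_det3[OF on]]) auto
    then show False
      using norm_N[OF m(1)] by simp
  qed
  have "0 \<notin> N"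
    using norm_N by force
  then have fin: "finite (D \<inter> {t<..t + pi})" for t
    unfolding D_def by (rule finite_plane_dirs[OF on finite_N])
  \<comment> \<open>Two different planes pass through \<open>v\<close>, so one of them misses the
    direction \<open>t\<close>; its form changes sign over half a turn. Hence gaps are shorter than
    pi.\<close>
  have mid: "\<exists>r\<in>D. t < r \<and> r < t + pi" for t
  proof -
    have "n0 \<bullet> circ p q t \<noteq> 0 \<or> n1 \<bullet> circ p q t \<noteq> 0"
    proof (rule ccontr)
      assume "\<not> ?thesis"
      then have z: "n0 \<bullet> circ p q t = 0" "n1 \<bullet> circ p q t = 0"
        by auto
      have "orthonormal3 v (circ p q t) (circ p q (t + pi / 2))"
        using on inner_circ_left[OF on] inner_circ_circ[OF on] by (simp add: orthonormal3_def)
      from unit_orthogonal_unique[OF orthonormal3_det3[OF this] norm_N[OF n1(1)] norm_N[OF n0(1)]]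
      have "n1 = n0 \<or> n1 = - n0"
        using n0 n1 z by blast
      then show False
        using n0 n1 by auto
    qed
    then obtain n where n: "n \<in> N" "n \<bullet> v = 0" "n \<bullet> circ p q t \<noteq> 0"
      using n0 n1 by blast
    have "(n \<bullet> circ p q t) * (n \<bullet> circ p q (t + pi)) < 0"
      using n(3) by (simp add: circ_add_pi mult_less_0_iff not_less less_le)
    then obtain r where "t < r" "r < t + pi" "n \<bullet> circ p q r = 0"
      using circ_sign_change[of t "t + pi" n p q] by auto
    then show ?thesis
      using n unfolding D_def plane_dirs_def by blast
  qed
  define nxt where "nxt t = Min (D \<inter> {t<..t + pi})" for t
  have nxt: "nxt t \<in> D" "t < nxt t" "nxt t < t + pi" "\<And>r. t < r \<Longrightarrow> r < nxt t \<Longrightarrow> r \<notin> D" for t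
  proof -
    obtain r where r: "r \<in> D" "t < r" "r < t + pi"
      using mid by blast
    have "nxt t \<in> D \<inter> {t<..t + pi}"
      unfolding nxt_def using r by (intro Min_in fin) auto
    then show "nxt t \<in> D" "t < nxt t"
      by auto
    have le: "nxt t \<le> r" if "r \<in> D" "t < r" "r \<le> t + pi" for r
      unfolding nxt_def using that by (intro Min_le fin) auto
    then show "nxt t < t + pi"
      using r by force
    show "r \<notin> D" if "t < r" "r < nxt t" for r
      using le[of r] that \<open>nxt t < t + pi\<close> by auto
  qed
  have nxt_eq: "nxt t = r" if "r \<in> D" "t < r" "\<And>r'. t < r' \<Longrightarrow> r' < r \<Longrightarrow> r' \<notin> D" for t r
    using that(1,2) that(3)[of "nxt t"] nxt(1,2)[of t] nxt(4)[of t r] by (meson linorder_neqE)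
  have nxt_pi: "nxt (t + pi) = nxt t + pi" for t
  proof (rule nxt_eq)
    show "nxt t + pi \<in> D" "t + pi < nxt t + pi"
      using nxt[of t] by (simp_all add: Dpi)
    show "r' \<notin> D" if "t + pi < r'" "r' < nxt t + pi" for r'
      using nxt(4)[of t "r' - pi"] that Dpi[of "r' - pi"] by auto
  qed
  \<comment> \<open>Starting half a turn early puts \<open>e\<close> at an index \<open>m\<close> >
    0, so that it has a predecessor as well as a successor among the natural numbers.\<close>
  define ts where "ts i = (nxt ^^ i) (- pi)" for i
  have ts_Suc: "ts (Suc i) = nxt (ts i)" for i
    by (simp add: ts_def)
  have ts0: "ts 0 = - pi"
    by (simp add: ts_def)
  have tsD: "ts i \<in> D" for i
    using D0(1) Dpi[of "- pi"] nxt(1) by (cases i) (simp_all add: ts0 ts_Suc)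
  have ts_less: "ts i < ts (Suc i)" "ts (Suc i) < ts i + pi" for i
    unfolding ts_Suc by (rule nxt)+
  have mono: "strict_mono ts"
    by (simp add: strict_mono_Suc_iff ts_less)
  \<comment> \<open>The walk cannot jump over the direction 0, and by finiteness it cannot stay
    below it forever.\<close>
  have "\<exists>m. ts m = 0"
  proof (rule ccontr)
    assume neg: "\<not> ?thesis"
    have lt: "ts i < 0" for i
    proof (induction i)
      case 0
      then show ?case
        by (simp add: ts0)
    next
      case (Suc i)
      have "\<not> 0 < ts (Suc i)"
        using nxt(4)[of "ts i" 0] Suc D0(1) by (auto simp: ts_Suc)
      moreover have "ts (Suc i) \<noteq> 0"
        using neg by blast
      ultimately show ?case
        by linarith
    qed
    have ge: "- pi \<le> ts i" for i
      using strict_mono_less_eq[OF mono, of 0 i] by (simp add: ts0)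
    have "range ts \<subseteq> insert (- pi) (D \<inter> {- pi<..- pi + pi})"
    proof
      fix r assume "r \<in> range ts"
      then obtain i where "r = ts i"
        by blast
      then show "r \<in> insert (- pi) (D \<inter> {- pi<..- pi + pi})"
        using lt[of i] ge[of i] tsD[of i] by auto
    qed
    then have "finite (range ts)"
      by (rule finite_subset) (simp only: finite_insert fin)
    then show False
      using strict_mono_imp_inj_on[OF mono] finite_imageD infinite_UNIV_nat by blast
  qed
  then obtain m where m: "ts m = 0"
    by blast
  have m0: "0 < m"
    using m ts0 by (cases m) auto
  have per: "ts (i + m) = ts i + pi" for i
    by (induction i) (simp_all add: m ts0 ts_Suc nxt_pi)
  \<comment> \<open>Chosen per direction, not per triangle; \<open>halfplane_edge_unique\<close>
    shows that both adjacent triangles yield this same vector.\<close>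
  define w where "w i = (SOME x. x \<in> halfplane v (circ p q (ts i)) \<and> (\<exists>y. tri v x y))" for i
  have w_eq: "w i = x" if "x \<in> halfplane v (circ p q (ts i))" "tri v x y" for i x y
  proof -
    have "w i \<in> halfplane v (circ p q (ts i)) \<and> (\<exists>y. tri v (w i) y)"
      unfolding w_def by (rule someI[of _ x]) (use that in blast)
    then show ?thesis
      using halfplane_edge_unique that by blast
  qed
  have w: "tri v (w i) (w (Suc i)) \<and> w i \<in> halfplane v (circ p q (ts i))" for i
  proof -
    obtain x y where xy: "tri v x y" "x \<in> halfplane v (circ p q (ts i))"
      "y \<in> halfplane v (circ p q (ts (Suc i)))"
      using sector_tri[OF on tsD[unfolded D_def] tsD[unfolded D_def] ts_less(1) ts_less(2), of i]
        nxt(4)[of "ts i", unfolded D_def] unfolding ts_Suc by metis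
    then have "w i = x" "w (Suc i) = y"
      using w_eq tri_swap(2) by blast+
    then show ?thesis
      using xy by simp
  qed
  have "nxt 0 = t1"
    using D0(2) t1(1) gap0 by (rule nxt_eq)
  then have "w m = e" "w (Suc m) = f"
    using w_eq[of e m f] w_eq[of f "Suc m" e] e f T tri_swap(2)[OF T] by (simp_all add: m ts_Suc)
  then show ?thesis
    using that[OF on m0, of w ts] w ts_less per m by blast
qed

end

section \<open>Reflections in walls\<close>

lemma halfplane_polar:
  assumes on: "orthonormal3 v p q" and w: "w \<in> halfplane v (circ p q t)" "norm w = 1"
  shows "w = (v \<bullet> w) *\<^sub>R v + sqrt (1 - (v \<bullet> w)\<^sup>2) *\<^sub>R circ p q t"
proof -
  obtain \<alpha> \<beta> where \<alpha>: "w = \<alpha> *\<^sub>R v + \<beta> *\<^sub>R circ p q t" "0 < \<beta>"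
    using w(1) unfolding halfplane_def by blast
  have i: "v \<bullet> v = 1" "v \<bullet> circ p q t = 0" "circ p q t \<bullet> v = 0" "circ p q t \<bullet> circ p q t = 1"
    using on inner_circ_left[OF on, of t] inner_circ_circ[OF on, of t t]
    by (simp_all add: orthonormal3_def inner_commute)
  have "v \<bullet> w = \<alpha>"
    by (simp add: \<alpha> inner_add_right i)
  moreover have "w \<bullet> w = \<alpha>\<^sup>2 + \<beta>\<^sup>2"
    by (simp add: \<alpha> inner_add_right inner_add_left i power2_eq_square)
  then have "sqrt (1 - \<alpha>\<^sup>2) = \<beta>"
    using w(2) \<alpha>(2) by (intro real_sqrt_unique) (auto simp: norm_eq_1)
  ultimately show ?thesis
    using \<alpha>(1) by simp
qed

text \<open>The spherical law of cosines in the frame at \<open>v\<close>: the angle of the triangle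
  at \<open>v\<close> is the difference of the directions of its edges.\<close>

lemma sector_sphere_angle:
  assumes on: "orthonormal3 v p q"
    and w: "w \<in> halfplane v (circ p q s)" "norm w = 1" "(v \<bullet> w)\<^sup>2 < 1"
    and w': "w' \<in> halfplane v (circ p q t)" "norm w' = 1" "(v \<bullet> w')\<^sup>2 < 1"
    and st: "s < t" "t < s + pi"
  shows "sphere_angle (w \<bullet> w') (v \<bullet> w) (v \<bullet> w') = t - s"
proof -
  define x x' k k' where d: "x = v \<bullet> w" "x' = v \<bullet> w'" "k = sqrt (1 - x\<^sup>2)" "k' = sqrt (1 - x'\<^sup>2)"
  have k: "k \<noteq> 0" "k' \<noteq> 0"
    using w(3) w'(3) by (auto simp: d)
  have i: "v \<bullet> v = 1" "v \<bullet> circ p q t = 0" "circ p q s \<bullet> v = 0" "circ p q s \<bullet> circ p q t = cos (t - s)"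
    using on inner_circ_left[OF on, of t] inner_circ_left[OF on, of s] inner_circ_circ[OF on, of s t]
    by (simp_all add: orthonormal3_def inner_commute)
  have e: "w = x *\<^sub>R v + k *\<^sub>R circ p q s" "w' = x' *\<^sub>R v + k' *\<^sub>R circ p q t"
    using halfplane_polar[OF on w(1,2)] halfplane_polar[OF on w'(1,2)] by (simp_all add: d)
  have "w \<bullet> w' = (x *\<^sub>R v + k *\<^sub>R circ p q s) \<bullet> (x' *\<^sub>R v + k' *\<^sub>R circ p q t)"
    by (simp only: e[symmetric])
  also have "\<dots> = x * x' + k * k' * cos (t - s)"
    by (simp add: inner_add_right inner_add_left i)
  finally have "(w \<bullet> w' - x * x') / (k * k') = cos (t - s)"
    using k by simp
  then show ?thesis
    unfolding sphere_angle_def d[symmetric] using st by (simp add: arccos_cos)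
qed

lemma reflection_along_unit:
  assumes "norm n = 1"
  shows "reflection_along n x = x - (2 * (n \<bullet> x)) *\<^sub>R n"
  using assms by (simp add: reflection_along_def norm_eq_1)

lemma reflection_along_uminus: "reflection_along (- n) = reflection_along n"
  by (simp add: reflection_along_def fun_eq_iff)

lemma orthogonal_transformation_reflection_along:
  "n \<noteq> 0 \<Longrightarrow> orthogonal_transformation (reflection_along n)"
  by (rule orthogonal_transformation_is_reflection) (auto simp: is_reflection_def)

lemma reflection_along_image:
  assumes "orthogonal_transformation f"
  shows "reflection_along (f n) (f x) = f (reflection_along n x)"
  using assms
  by (simp add: reflection_along_def orthogonal_transformation_def linear_diff linear_scale)

context congruent_simplicial
begin

text \<open>The first claim holds in both alternatives of the dichotomy; collected over the three
  vertices of a triangle it becomes the hypothesis of the second claim, which excludes the mixed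
  alternative.\<close>

lemma vertex_reflection:
  assumes T: "tri v e f"
    and phi: "\<And>x y z. {#x, y, z#} = M \<Longrightarrow> sphere_angle x y z = \<phi> x"
      "\<And>k. k \<in># M \<Longrightarrow> 0 < \<phi> k" "inj_on \<phi> (set_mset M)" "pi < (\<Sum>k\<in>#M. \<phi> k)"
  shows "2 * \<phi> (e \<bullet> f) \<le> pi"
    and "(\<And>k. k \<in># M \<Longrightarrow> 2 * \<phi> k \<le> pi) \<Longrightarrow> n \<in> N \<Longrightarrow> n \<bullet> v = 0 \<Longrightarrow> n \<bullet> e = 0 \<Longrightarrow>
      tri v e (reflection_along n f)"
proof -
  obtain p q ts w m where on: "orthonormal3 v p q" and m: "0 < m"
    and w: "\<And>i. tri v (w i) (w (Suc i))" "\<And>i. w i \<in> halfplane v (circ p q (ts i))"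
    and ts: "\<And>i. ts i < ts (Suc i)" "\<And>i. ts (Suc i) < ts i + pi" "\<And>i. ts (i + m) = ts i + pi"
    and at: "ts m = 0" "w m = e" "w (Suc m) = f"
    using vertex_cycle[OF T] by metis
  define x y where xy: "x i = v \<bullet> w i" "y i = w i \<bullet> w (Suc i)" for i
  have M: "{#y i, x i, x (Suc i)#} = M" for i
    using triD(5)[OF w(1)[of i]] by (simp add: xy add_mset_commute)
  have M': "{#x i, x (Suc i), y i#} = M" for i
    unfolding M[of i, symmetric] by (simp add: add_mset_commute)
  have yM: "y i \<in># M" for i
    by (simp flip: M[of i])
  have wn: "norm (w i) = 1" for i
    using triD(2)[OF w(1)] .
  have x1: "(v \<bullet> w i)\<^sup>2 < 1" for i
    using spherical_sides_of_unit_vectors[OF triD(1-4)[OF w(1)[of i]]] by (simp add: spherical_sides_def)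
  have tau: "\<phi> (y i) = ts (Suc i) - ts i" for i
    using sector_sphere_angle[OF on w(2) wn x1 w(2) wn x1 ts(1,2), of i] phi(1)[OF M[of i]]
    by (simp add: xy)
  have per: "\<phi> (y (i + m)) = \<phi> (y i)" for i
    using ts(3)[of i] ts(3)[of "Suc i"] by (simp add: tau)
  have "(\<Sum>i<m. \<phi> (y i)) = ts m - ts 0"
    unfolding tau by (rule sum_lessThan_telescope)
  then have tot: "(\<Sum>i<m. \<phi> (y i)) = pi"
    using ts(3)[of 0] by simp
  have dich: "(\<forall>i. y i = y 0) \<or>
      (\<exists>p q r. M = {#p, q, r#} \<and> 2 * \<phi> p + 2 * \<phi> q \<le> pi \<and> (\<forall>i. y i \<in> {p, q}))"
    by (rule cyclic_labelling_dichotomy[OF M' _ phi(3,4) per tot m]) (rule phi(2))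
  have ym: "y m = e \<bullet> f"
    by (simp add: xy at)
  show "2 * \<phi> (e \<bullet> f) \<le> pi"
    using dich
  proof (elim disjE exE conjE)
    assume c: "\<forall>i. y i = y 0"
    have "(\<Sum>i<m. \<phi> (y i)) = (\<Sum>i<m. \<phi> (y 0))"
      by (intro sum.cong refl arg_cong[of _ _ \<phi>]) (use c in blast)
    then have s: "m * \<phi> (y 0) = pi"
      using tot by simp
    have "\<phi> (y 0) < pi"
      using tau[of 0] ts(2)[of 0] by simp
    then have "m \<noteq> 1"
      using s by auto
    then have "2 \<le> real m"
      using m by simp
    then have "2 * \<phi> (y 0) \<le> m * \<phi> (y 0)"
      using phi(2)[OF yM, of 0] by (intro mult_right_mono) auto
    then show ?thesis
      using s c ym by metis
  next
    fix p q r assume a: "M = {#p, q, r#}" "2 * \<phi> p + 2 * \<phi> q \<le> pi" "\<forall>i. y i \<in> {p, q}"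
    then have pos: "0 < \<phi> p" "0 < \<phi> q"
      using phi(2) by auto
    consider "y m = p" | "y m = q"
      using a(3) by blast
    then show ?thesis
      unfolding ym[symmetric] using a(2) pos by cases simp_all
  qed
  assume small: "\<And>k. k \<in># M \<Longrightarrow> 2 * \<phi> k \<le> pi" and n: "n \<in> N" "n \<bullet> v = 0" "n \<bullet> e = 0"
  \<comment> \<open>In the mixed alternative \<phi> p + \<phi> q and \<phi> r are both at most pi /
    2, contradicting the angle sum.\<close>
  have c: "\<forall>i. y i = y 0"
    using dich
  proof (elim disjE exE conjE)
    fix p q r assume a: "M = {#p, q, r#}" "2 * \<phi> p + 2 * \<phi> q \<le> pi"
    then have "2 * \<phi> r \<le> pi"
      using small by simp
    moreover have "pi < \<phi> p + \<phi> q + \<phi> r"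
      using phi(4) a(1) by simp
    ultimately show ?thesis
      using a(2) by linarith
  qed
  obtain k where k: "m = Suc k"
    using m by (cases m) auto
  have yk: "y k = y m"
    using c by metis
  \<comment> \<open>The triangles before and after \<open>e\<close> share the label
    \<open>x m\<close> and have equal opposite labels, so their remaining labels agree as
    well.\<close>
  have "{#y m, x k, x m#} = {#y m, x m, x (Suc m)#}"
    using M[of k] M[of m] unfolding yk k[symmetric] by metis
  then have xk: "x k = x (Suc m)"
    by (auto simp: add_eq_conv_ex)
  define \<tau> where "\<tau> = ts (Suc m)"
  have tk: "ts k = - \<tau>"
    using tau[of k] tau[of m] at(1) by (simp add: yk \<tau>_def k[symmetric])
  define X S where XS: "X = x (Suc m)" "S = sqrt (1 - X\<^sup>2)"
  have f: "f = X *\<^sub>R v + S *\<^sub>R circ p q \<tau>"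
    using halfplane_polar[OF on w(2) wn, of "Suc m"] by (simp add: XS xy \<tau>_def at)
  have wk: "w k = X *\<^sub>R v + S *\<^sub>R circ p q (- \<tau>)"
    using halfplane_polar[OF on w(2) wn, of k] xk by (simp add: XS xy tk)
  \<comment> \<open>Orthogonality to \<open>v\<close> and \<open>e\<close> makes \<open>n\<close>
    equal to \<open>q\<close> up to sign, so the reflection sends the direction \<tau> of
    \<open>f\<close> to - \<tau>, which is the direction of \<open>w k\<close>.\<close>
  have np: "n \<bullet> p = 0"
    using w(2)[of m] n unfolding at halfplane_def by (auto simp: circ_def inner_add_right)
  have nq: "n = (n \<bullet> q) *\<^sub>R q"
    by (subst orthonormal3_expand[OF on, of n]) (simp add: n np)
  have qq: "q \<bullet> q = 1" "norm q = 1"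
    using on by (simp_all add: orthonormal3_def norm_eq_1)
  have "n \<bullet> n = 1"
    using norm_N[OF n(1)] by (simp add: norm_eq_1)
  moreover have "n \<bullet> n = (n \<bullet> q) * (n \<bullet> q)"
    by (subst (2) nq) simp
  ultimately have n2: "(n \<bullet> q) * (n \<bullet> q) = 1"
    by simp
  have "n \<bullet> f = S * sin \<tau> * (n \<bullet> q)"
    unfolding f by (simp add: inner_add_right inner_circ n np)
  then have "(n \<bullet> f) *\<^sub>R n = (S * sin \<tau> * (n \<bullet> q)) *\<^sub>R ((n \<bullet> q) *\<^sub>R q)"
    using nq by simp
  also have "\<dots> = (S * sin \<tau>) *\<^sub>R q"
    using n2 by (simp add: mult.assoc)
  finally have "reflection_along n f = f - 2 *\<^sub>R ((S * sin \<tau>) *\<^sub>R q)"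
    using norm_N[OF n(1)] by (simp add: reflection_along_unit flip: scaleR_scaleR)
  also have "\<dots> = w k"
    unfolding f wk circ_def by (simp add: algebra_simps flip: scaleR_2)
  finally have "reflection_along n f = w k" .
  moreover have "tri v (w m) (w k)"
    using tri_swap(2)[OF w(1)[of k]] k by simp
  ultimately show "tri v e (reflection_along n f)"
    by (simp add: at)
qed

text \<open>Each label of \<open>M\<close> is the side opposite to some vertex of the triangle, so
  the angle bound at the three vertices covers all labels.\<close>

lemma wall_reflection:
  assumes T: "tri a b c" and n: "n \<in> N" "n \<bullet> a = 0" "n \<bullet> b = 0"
  shows "tri a b (reflection_along n c)"
proof -
  note M = triD(5)[OF T]
  obtain \<phi> where phi: "\<And>x y z. {#x, y, z#} = M \<Longrightarrow> sphere_angle x y z = \<phi> x"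
      "\<And>k. k \<in># M \<Longrightarrow> 0 < \<phi> k" "inj_on \<phi> (set_mset M)" "pi < (\<Sum>k\<in>#M. \<phi> k)"
    using sphere_angle_as_function[OF spherical_sides_of_unit_vectors[OF triD(1-4)[OF T]], unfolded M]
    by blast
  have "2 * \<phi> k \<le> pi" if "k \<in># M" for k
  proof -
    have "k = b \<bullet> c \<or> k = a \<bullet> c \<or> k = a \<bullet> b"
      using that unfolding M[symmetric] by auto
    moreover have "tri b a c" "tri c a b"
      using T tri_swap by blast+
    ultimately show ?thesis
      using vertex_reflection(1)[OF _ phi] T by metis
  qed
  then show ?thesis
    using vertex_reflection(2)[OF T phi _ n] by blast
qed

end

section \<open>Generic points of subspaces\<close>

lemma subspace_avoids_hyperplanes:
  fixes S :: "'a::real_inner set"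
  assumes "finite F" "subspace S" "\<And>m. m \<in> F \<Longrightarrow> \<exists>x\<in>S. m \<bullet> x \<noteq> 0"
  obtains x where "x \<in> S" "\<And>m. m \<in> F \<Longrightarrow> m \<bullet> x \<noteq> 0"
proof -
  have "\<exists>x\<in>S. \<forall>m\<in>F. m \<bullet> x \<noteq> 0"
    using assms(1,3)
  proof (induction F rule: finite_induct)
    case empty
    then show ?case
      using subspace_0[OF assms(2)] by auto
  next
    case (insert m F)
    obtain x where x: "x \<in> S" "\<And>m. m \<in> F \<Longrightarrow> m \<bullet> x \<noteq> 0"
      using insert.IH insert.prems by auto
    obtain y where y: "y \<in> S" "m \<bullet> y \<noteq> 0"
      using insert.prems by auto
    \<comment> \<open>The parameters at which the line through \<open>x\<close> in direction
      \<open>y\<close> meets one of the hyperplanes; forms constant along the line contribute a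
      harmless value through division by 0.\<close>
    have "finite ((\<lambda>k. - (k \<bullet> x) / (k \<bullet> y)) ` insert m F)"
      using insert.hyps by simp
    then obtain t where t: "t \<notin> (\<lambda>k. - (k \<bullet> x) / (k \<bullet> y)) ` insert m F"
      using ex_new_if_finite[OF infinite_UNIV_char_0] by blast
    have "k \<bullet> (x + t *\<^sub>R y) \<noteq> 0" if k: "k \<in> insert m F" for k
    proof
      assume eq: "k \<bullet> (x + t *\<^sub>R y) = 0"
      then have e: "k \<bullet> x = - (t * (k \<bullet> y))"
        by (simp add: inner_add_right)
      show False
      proof (cases "k \<bullet> y = 0")
        case True
        then show False
          using e k x(2) y(2) by auto
      next
        case False
        then have "t = - (k \<bullet> x) / (k \<bullet> y)"
          using e by simp
        then show False
          using t k by blast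
      qed
    qed
    moreover have "x + t *\<^sub>R y \<in> S"
      using x y assms(2) by (simp add: subspace_add subspace_scale)
    ultimately show ?case
      by blast
  qed
  then show ?thesis
    using that by blast
qed

text \<open>The component of \<open>m\<close> orthogonal to \<open>n\<close> is killed by
  \<open>n\<close>, hence by \<open>m\<close>, hence orthogonal to itself.\<close>

lemma unit_hyperplane_unique:
  fixes m n :: "'a::real_inner"
  assumes "norm m = 1" "norm n = 1" and sub: "\<And>x. n \<bullet> x = 0 \<Longrightarrow> m \<bullet> x = 0"
  shows "m = n \<or> m = - n"
proof -
  have nn: "n \<bullet> n = 1" "m \<bullet> m = 1"
    using assms by (simp_all add: norm_eq_1)
  define k where "k = n \<bullet> m"
  have "n \<bullet> (m - k *\<^sub>R n) = 0"
    by (simp add: inner_diff_right nn k_def)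
  then have z: "m \<bullet> (m - k *\<^sub>R n) = 0"
    by (rule sub)
  have "(m - k *\<^sub>R n) \<bullet> (m - k *\<^sub>R n) = m \<bullet> (m - k *\<^sub>R n) - k * (n \<bullet> (m - k *\<^sub>R n))"
    by (simp add: inner_diff_left)
  then have "m - k *\<^sub>R n = 0"
    using z \<open>n \<bullet> (m - k *\<^sub>R n) = 0\<close> by simp
  then have mk: "m = k *\<^sub>R n"
    by simp
  then have "\<bar>k\<bar> = 1"
    using assms(1,2) by simp
  then show ?thesis
    using mk by (cases "k < 0") auto
qed

section \<open>Galleries, and normals closed under reflection\<close>

context congruent_simplicial
begin

lemma tri_orthogonal_image:
  assumes "tri a b c" "orthogonal_transformation f" "chamber N (ocone (f a) (f b) (f c))"
  shows "tri (f a) (f b) (f c)"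
proof -
  have "det3 (f a) (f b) (f c) \<noteq> 0"
    using det3_orthogonal_transformation[OF assms(2), of a b c] triD(4)[OF assms(1)] by auto
  then show ?thesis
    using triD[OF assms(1)] assms(2,3) unfolding tri_def
    by (simp add: orthogonal_transformation_norm) (simp add: orthogonal_transformation_def)
qed

text \<open>A point of the plane on no other plane, pushed slightly along \<open>n\<close>, enters a
  chamber whose closure still contains the point.\<close>

lemma normal_is_wall:
  assumes n: "n \<in> N"
  obtains a b c where "tri a b c" "n \<bullet> a = 0" "n \<bullet> b = 0"
proof -
  have sub: "subspace {x. n \<bullet> x = 0}"
    by (rule subspace_hyperplane)
  have ex: "\<exists>x\<in>{x. n \<bullet> x = 0}. m \<bullet> x \<noteq> 0" if "m \<in> N - {n, - n}" for m
    using unit_hyperplane_unique[OF norm_N[of m] norm_N[OF n]] that by auto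
  have "finite (N - {n, - n})"
    using finite_N by simp
  then obtain p where "p \<in> {x. n \<bullet> x = 0}" and p: "\<And>m. m \<in> N - {n, - n} \<Longrightarrow> m \<bullet> p \<noteq> 0"
    using subspace_avoids_hyperplanes[of "N - {n, - n}" "{x. n \<bullet> x = 0}"] sub ex by blast
  then have p: "n \<bullet> p = 0" "\<And>m. m \<in> N - {n, - n} \<Longrightarrow> m \<bullet> p \<noteq> 0"
    by auto
  obtain \<epsilon> where eps: "0 < \<epsilon>" "\<And>m. m \<in> N \<Longrightarrow> m \<bullet> p \<noteq> 0 \<Longrightarrow> \<epsilon> < \<bar>m \<bullet> p\<bar>"
    using vertex_margin[of p] by metis
  have nn: "n \<bullet> n = 1"
    using norm_N[OF n] by (simp add: norm_eq_1)
  define z where "z = p + \<epsilon> *\<^sub>R n"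
  have mz: "m \<bullet> z = m \<bullet> p + \<epsilon> * (m \<bullet> n)" for m
    by (simp add: z_def inner_add_right)
  have pos: "0 < (m \<bullet> z) * (m \<bullet> p)" if m: "m \<in> N" "m \<bullet> p \<noteq> 0" for m
  proof -
    have "\<bar>m \<bullet> n\<bar> \<le> 1"
      using Cauchy_Schwarz_ineq2[of m n] norm_N n m by simp
    then have "\<bar>\<epsilon> * (m \<bullet> n)\<bar> \<le> \<epsilon>"
      using eps(1) by (simp add: abs_mult)
    then show ?thesis
      using eps(2)[OF m] unfolding mz by (auto simp: zero_less_mult_iff)
  qed
  have "m \<bullet> z \<noteq> 0" if m: "m \<in> N" for m
  proof (cases "m \<bullet> p = 0")
    case True
    then have "m = n \<or> m = - n"
      using p(2)[of m] m by blast
    then show ?thesis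
      using eps(1) nn p(1) by (auto simp: mz)
  qed (use pos[OF m] in force)
  then have "z \<in> cell N z"
    by (simp add: self_in_cell_iff)
  then obtain a b c where T: "tri a b c" "z \<in> ocone a b c"
    by (rule cell_is_tri)
  have "0 \<le> (m \<bullet> z) * (m \<bullet> p)" if "m \<in> N" for m
    using pos[OF that] by (cases "m \<bullet> p = 0") (auto intro: less_imp_le)
  then obtain \<alpha> \<beta> \<gamma> where c: "0 \<le> \<alpha>" "0 \<le> \<beta>" "0 \<le> \<gamma>" "p = \<alpha> *\<^sub>R a + \<beta> *\<^sub>R b + \<gamma> *\<^sub>R c"
    using tri_closed_cone[OF T] by metis
  obtain m where m: "m = n \<or> m = - n" "0 \<le> m \<bullet> a" "0 \<le> m \<bullet> b" "0 \<le> m \<bullet> c" "0 < m \<bullet> z"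
    using tri_sign[OF T(1) n] T(2) by metis
  then have "m = n"
    using eps(1) nn p(1) by (auto simp: mz)
  have "\<alpha> * (n \<bullet> a) + \<beta> * (n \<bullet> b) + \<gamma> * (n \<bullet> c) = 0"
    using p(1) unfolding c(4) by (simp add: inner_add_right)
  then have zero: "\<alpha> * (n \<bullet> a) = 0" "\<beta> * (n \<bullet> b) = 0" "\<gamma> * (n \<bullet> c) = 0"
    using mult_nonneg_nonneg[OF c(1) m(2)] mult_nonneg_nonneg[OF c(2) m(3)]
      mult_nonneg_nonneg[OF c(3) m(4)] unfolding \<open>m = n\<close> by linarith+
  \<comment> \<open>Otherwise \<open>p\<close> is a multiple of the vertex \<open>a'\<close> and
    lies on the wall through \<open>a'\<close> and \<open>b'\<close>. By genericity this wall is the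
    plane of \<open>n\<close>, so \<open>n\<close> vanishes on \<open>b'\<close> after all.\<close>
  have one: "n \<bullet> b' = 0 \<or> n \<bullet> c' = 0"
    if T': "tri a' b' c'" and p': "p = \<alpha>' *\<^sub>R a' + \<beta>' *\<^sub>R b' + \<gamma>' *\<^sub>R c'"
      and z': "\<beta>' * (n \<bullet> b') = 0" "\<gamma>' * (n \<bullet> c') = 0" for a' b' c' \<alpha>' \<beta>' \<gamma>'
  proof (rule ccontr)
    assume neg: "\<not> ?thesis"
    obtain k where k: "k \<in> N" "k \<bullet> a' = 0" "k \<bullet> b' = 0"
      using tri_wall[OF T'] by metis
    have "k \<bullet> p = 0"
      using neg z' k unfolding p' by (auto simp: inner_add_right)
    then have "k = n \<or> k = - n"
      using p(2)[of k] k(1) by blast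
    then show False
      using k neg by auto
  qed
  have "n \<bullet> b = 0 \<or> n \<bullet> c = 0"
    using one[OF T(1) c(4)] zero by blast
  moreover have "n \<bullet> a = 0 \<or> n \<bullet> c = 0"
    using one[of b a c \<beta> \<alpha> \<gamma>, OF tri_swap(1)[OF T(1)]] zero c(4) by (auto simp: add_ac)
  moreover have "n \<bullet> a = 0 \<or> n \<bullet> b = 0"
    using one[of c a b \<gamma> \<alpha> \<beta>, OF tri_swap(1)[OF tri_swap(2)[OF T(1)]]] zero c(4) by (auto simp: add_ac)
  ultimately consider "n \<bullet> a = 0" "n \<bullet> b = 0" | "n \<bullet> a = 0" "n \<bullet> c = 0" | "n \<bullet> b = 0" "n \<bullet> c = 0"
    by blast
  then show ?thesis
    using that T(1) tri_swap by cases blast+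
qed

text \<open>Induction on the distance to a base chamber having a wall in the plane of
  \<open>n\<close>. Crossing a wall \<open>m\<close> of a chamber corresponds to crossing the wall
  \<open>?s m\<close> of its image, and \<open>wall_reflection\<close> governs both
  crossings.\<close>

lemma reflection_tri:
  assumes n: "n \<in> N" and "tri a b c"
  shows "tri (reflection_along n a) (reflection_along n b) (reflection_along n c)"
proof -
  let ?s = "reflection_along n"
  have "n \<noteq> 0"
    using norm_N[OF n] by auto
  then have orth: "orthogonal_transformation ?s"
    by (rule orthogonal_transformation_reflection_along)
  then have lin: "linear ?s" and norm_s: "\<And>x. norm (?s x) = norm x"
    and inner_s: "\<And>x y. ?s x \<bullet> ?s y = x \<bullet> y"
    by (auto simp: orthogonal_transformation_linear orthogonal_transformation_norm orthogonal_transformation_def)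
  obtain a0 b0 c0 where T0: "tri a0 b0 c0" "n \<bullet> a0 = 0" "n \<bullet> b0 = 0"
    using normal_is_wall[OF n] by metis
  define x0 where "x0 = 1 *\<^sub>R a0 + 1 *\<^sub>R b0 + 1 *\<^sub>R c0"
  have x0: "x0 \<in> ocone a0 b0 c0"
    unfolding x0_def by (rule ocone_memI) simp_all
  have gen: "k \<bullet> x0 \<noteq> 0" if "k \<in> N" for k
    using chamber_eq_cell(2)[OF triD(6)[OF T0(1)] x0] that by (simp add: self_in_cell_iff)
  \<comment> \<open>Both normals of every separating plane are counted; only the strict decrease
    matters.\<close>
  define sep where "sep x = {k \<in> N. (k \<bullet> x) * (k \<bullet> x0) < 0}" for x
  have main: "tri (?s a) (?s b) (?s c)" if "tri a b c" "x \<in> ocone a b c" for a b c x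
    using that
  proof (induction "card (sep x)" arbitrary: a b c x rule: less_induct)
    case less
    obtain \<alpha> \<beta> \<gamma> where x0c: "x0 = \<alpha> *\<^sub>R a + \<beta> *\<^sub>R b + \<gamma> *\<^sub>R c"
      by (rule det3_coordinates[OF triD(4)[OF less.prems(1)]])
    \<comment> \<open>A coordinate of \<open>x0\<close> that is not positive means that the opposite
      wall separates the chamber from the base chamber; it is the wall to cross.\<close>
    have step: "tri (?s a) (?s b) (?s c)"
      if T: "tri a b c" and x: "x \<in> ocone a b c" and x0c: "x0 = \<alpha> *\<^sub>R a + \<beta> *\<^sub>R b + \<gamma> *\<^sub>R c"
        and neg: "\<not> 0 < \<gamma>" for a b c \<alpha> \<beta> \<gamma>
    proof -
      obtain m where m: "m \<in> N" "m \<bullet> a = 0" "m \<bullet> b = 0" "0 < m \<bullet> c"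
        by (rule tri_wall[OF T])
      let ?r = "reflection_along m"
      have "m \<bullet> x0 = \<gamma> * (m \<bullet> c)"
        using m by (simp add: x0c inner_add_right)
      then have mx0: "m \<bullet> x0 < 0"
        using gen[OF m(1)] m(4) neg by (auto simp: mult_less_0_iff)
      have T': "tri a b (?r c)"
        using wall_reflection[OF T m(1-3)] .
      have r: "?r a = a" "?r b = b"
        using m by (simp_all add: reflection_along_def)
      have "m \<noteq> 0"
        using m by auto
      then have lin_r: "linear ?r"
        using orthogonal_transformation_reflection_along orthogonal_transformation_linear by blast
      have x': "?r x \<in> ocone a b (?r c)"
        using ocone_linear_image[OF lin_r, of a b c] x by (auto simp: r)
      have mr: "m \<bullet> ?r x = - (m \<bullet> x)"
        using norm_N[OF m(1)] by (simp add: reflection_along_unit inner_diff_right norm_eq_1)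
      have pm: "0 < m \<bullet> x"
      proof -
        obtain k where "k = m \<or> k = - m" "0 \<le> k \<bullet> c" "0 < k \<bullet> x"
          using tri_sign[OF T m(1)] x by metis
        then show ?thesis
          using m(4) by auto
      qed
      \<comment> \<open>Any other plane is nonzero on one of the common vertices \<open>a\<close>,
        \<open>b\<close>, which fixes its side for both neighbouring chambers.\<close>
      have same: "0 < (k \<bullet> x) * (k \<bullet> ?r x)" if k: "k \<in> N" "k \<noteq> m" "k \<noteq> - m" for k
      proof -
        obtain k1 where k1: "k1 = k \<or> k1 = - k" "0 \<le> k1 \<bullet> a" "0 \<le> k1 \<bullet> b" "0 < k1 \<bullet> x"
          using tri_sign[OF T k(1)] x by metis
        obtain k2 where k2: "k2 = k \<or> k2 = - k" "0 \<le> k2 \<bullet> a" "0 \<le> k2 \<bullet> b" "0 < k2 \<bullet> ?r x"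
          using tri_sign[OF T' k(1)] x' by metis
        have "k \<bullet> a \<noteq> 0 \<or> k \<bullet> b \<noteq> 0"
          using unit_orthogonal_unique[OF triD(4)[OF T] norm_N[OF k(1)] norm_N[OF m(1)]] m k by blast
        then have "k1 = k2"
          using k1 k2 by auto
        then show ?thesis
          using k1 k2 by (auto simp: zero_less_mult_iff)
      qed
      have "sep (?r x) \<subset> sep x"
      proof
        show "sep (?r x) \<subseteq> sep x"
        proof
          fix k assume k: "k \<in> sep (?r x)"
          then have kN: "k \<in> N" and kn: "(k \<bullet> ?r x) * (k \<bullet> x0) < 0"
            by (auto simp: sep_def)
          have "k \<noteq> m" "k \<noteq> - m"
            using kn mr pm mx0 by (auto simp: mult_less_0_iff)
          from same[OF kN this] show "k \<in> sep x"
            using kN kn by (auto simp: sep_def mult_less_0_iff zero_less_mult_iff)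
        qed
        have "m \<in> sep x" "m \<notin> sep (?r x)"
          using m(1) pm mx0 mr by (auto simp: sep_def mult_less_0_iff)
        then show "sep (?r x) \<noteq> sep x"
          by blast
      qed
      moreover have "finite (sep x)"
        using finite_N by (simp add: sep_def)
      ultimately have "card (sep (?r x)) < card (sep x)"
        by (rule psubset_card_mono[rotated])
      from less.hyps[OF this T' x'] have T'': "tri (?s a) (?s b) (?s (?r c))" .
      \<comment> \<open>The wall of the image through \<open>?s a\<close> and \<open>?s b\<close> is
        \<open>?s m\<close> up to sign, so reflecting in it undoes the conjugate of
        \<open>?r\<close>.\<close>
      obtain k where k: "k \<in> N" "k \<bullet> ?s a = 0" "k \<bullet> ?s b = 0"
        using tri_wall[OF T''] by metis
      have "k = ?s m \<or> k = - ?s m"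
        using k m norm_N by (intro unit_orthogonal_unique[OF triD(4)[OF T'']]) (auto simp: norm_s inner_s)
      then have "reflection_along k = reflection_along (?s m)"
        using reflection_along_uminus by metis
      then have "reflection_along k (?s (?r c)) = ?s c"
        by (simp add: reflection_along_image[OF orth] reflection_along_involution)
      then show ?thesis
        using wall_reflection[OF T'' k] by simp
    qed
    note T = less.prems(1) and x = less.prems(2)
    show ?case
    proof (cases "0 < \<alpha> \<and> 0 < \<beta> \<and> 0 < \<gamma>")
      case True
      then have "x0 \<in> ocone a b c"
        unfolding x0c by (intro ocone_memI) auto
      then have eq: "ocone a b c = ocone a0 b0 c0"
        using chamber_eq_cell(1)[OF triD(6)[OF T]] chamber_eq_cell(1)[OF triD(6)[OF T0(1)] x0] by blast
      \<comment> \<open>Base chamber: here \<open>?s\<close> is the reflection in one of its own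
        walls.\<close>
      have "?s a0 = a0" "?s b0 = b0"
        using T0 by (simp_all add: reflection_along_def)
      then have "ocone (?s a) (?s b) (?s c) = ocone a0 b0 (?s c0)"
        using eq ocone_linear_image[OF lin] by metis
      then show ?thesis
        using triD(6)[OF wall_reflection[OF T0(1) n T0(2,3)]]
        by (intro tri_orthogonal_image[OF T orth]) simp
    next
      case False
      then consider "\<not> 0 < \<gamma>" | "\<not> 0 < \<beta>" | "\<not> 0 < \<alpha>"
        by blast
      then show ?thesis
      proof cases
        case 1
        then show ?thesis
          by (rule step[OF T x x0c])
      next
        case 2
        have "tri (?s a) (?s c) (?s b)"
          by (rule step[of a c b \<alpha> \<gamma> \<beta>, OF tri_swap(2)[OF T] _ _ 2]) (use x x0c in \<open>simp_all add: ocone_swap add_ac\<close>)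
        then show ?thesis
          by (rule tri_swap(2))
      next
        case 3
        have "x \<in> ocone c b a"
          using x ocone_swap by metis
        moreover have "tri c b a"
          using T tri_swap by blast
        ultimately have "tri (?s c) (?s b) (?s a)"
          by (intro step[of c b a \<gamma> \<beta> \<alpha>, OF _ _ _ 3]) (simp_all add: x0c add_ac)
        then show ?thesis
          using tri_swap by blast
      qed
    qed
  qed
  show ?thesis
    by (rule main[OF assms(2), of "1 *\<^sub>R a + 1 *\<^sub>R b + 1 *\<^sub>R c"]) (rule ocone_memI; simp)
qed

text \<open>The plane of \<open>m\<close> is a wall of some chamber; its image contains two vertices
  of the image chamber and is therefore the wall there.\<close>

lemma reflection_N:
  assumes n: "n \<in> N" and m: "m \<in> N"
  shows "reflection_along n m \<in> N"
proof -
  have "n \<noteq> 0"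
    using norm_N[OF n] by auto
  then have orth: "orthogonal_transformation (reflection_along n)"
    by (rule orthogonal_transformation_reflection_along)
  obtain a b c where T: "tri a b c" "m \<bullet> a = 0" "m \<bullet> b = 0"
    using normal_is_wall[OF m] by metis
  note T' = reflection_tri[OF n T(1)]
  obtain k where k: "k \<in> N" "k \<bullet> reflection_along n a = 0" "k \<bullet> reflection_along n b = 0"
    using tri_wall[OF T'] by metis
  have "reflection_along n m \<bullet> reflection_along n x = m \<bullet> x" "norm (reflection_along n m) = 1" for x
    using orth orthogonal_transformation_norm[OF orth] norm_N[OF m]
    by (auto simp: orthogonal_transformation_def)
  then have "reflection_along n m = k \<or> reflection_along n m = - k"
    using T k norm_N[OF k(1)] by (intro unit_orthogonal_unique[OF triD(4)[OF T']]) auto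
  then show ?thesis
    using k uminus_N by auto
qed

end

section \<open>Existence of a simplicial chamber\<close>

lemma det3_scale: "det3 (k *\<^sub>R a) (l *\<^sub>R b) (r *\<^sub>R c) = k * l * r * det3 a b c"
  unfolding det3_components vector_scaleR_component real_scaleR_def by algebra

lemma det3_cross3: "det3 (cross3 b c) (cross3 c a) (cross3 a b) = (det3 a b c)\<^sup>2"
  unfolding det3_components cross3_def by (simp, algebra)

lemma det3_dual_basis:
  assumes "det3 f g h \<noteq> 0"
  obtains a b c where "det3 a b c \<noteq> 0"
    "\<And>y. y = (f \<bullet> y) *\<^sub>R a + (g \<bullet> y) *\<^sub>R b + (h \<bullet> y) *\<^sub>R c"
    "\<And>r s t. f \<bullet> (r *\<^sub>R a + s *\<^sub>R b + t *\<^sub>R c) = r"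
    "\<And>r s t. g \<bullet> (r *\<^sub>R a + s *\<^sub>R b + t *\<^sub>R c) = s"
    "\<And>r s t. h \<bullet> (r *\<^sub>R a + s *\<^sub>R b + t *\<^sub>R c) = t"
proof -
  define D where "D = det3 f g h"
  have D: "D \<noteq> 0"
    using assms by (simp add: D_def)
  define a b c where abc: "a = (1 / D) *\<^sub>R cross3 g h" "b = (1 / D) *\<^sub>R cross3 h f" "c = (1 / D) *\<^sub>R cross3 f g"
  have cyc: "f \<bullet> cross3 g h = D" "g \<bullet> cross3 h f = D" "h \<bullet> cross3 f g = D"
    using det3_swap[of f g h] det3_swap[of f h g] det3_swap[of g f h] det3_swap[of h f g] det3_swap[of g h f]
    by (simp_all add: D_def det3_def)
  have i: "f \<bullet> a = 1" "f \<bullet> b = 0" "f \<bullet> c = 0" "g \<bullet> a = 0" "g \<bullet> b = 1" "g \<bullet> c = 0"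
    "h \<bullet> a = 0" "h \<bullet> b = 0" "h \<bullet> c = 1"
    using D cyc by (simp_all add: abc dot_cross_self)
  have "det3 a b c = (1 / D) * (1 / D) * (1 / D) * D\<^sup>2"
    unfolding abc det3_scale det3_cross3 D_def ..
  then have d: "det3 a b c \<noteq> 0"
    using D by simp
  have e: "y = (f \<bullet> y) *\<^sub>R a + (g \<bullet> y) *\<^sub>R b + (h \<bullet> y) *\<^sub>R c" for y
  proof -
    have "y - ((f \<bullet> y) *\<^sub>R a + (g \<bullet> y) *\<^sub>R b + (h \<bullet> y) *\<^sub>R c) = 0" (is "?z = 0")
    proof (rule det3_orthogonal_eq_0[OF assms])
      show "?z \<bullet> f = 0" "?z \<bullet> g = 0" "?z \<bullet> h = 0"
        by (simp_all add: inner_commute[of ?z] inner_diff_right inner_add_right i)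
    qed
    then show ?thesis
      by simp
  qed
  show ?thesis
    by (rule that[OF d e]) (simp_all add: inner_add_right i)
qed

definition open_dual_cone :: "(real^3) \<times> (real^3) \<times> (real^3) \<Rightarrow> (real^3) set" where
  "open_dual_cone = (\<lambda>(f, g, h). {y. 0 < f \<bullet> y \<and> 0 < g \<bullet> y \<and> 0 < h \<bullet> y})"

text \<open>An inclusion-minimal open simplicial cone bounded by planes of the arrangement is cut by no
  plane, for a plane cutting it would cut off a smaller simplicial cone.\<close>

lemma (in unit_normals) exists_simplicial_chamber:
  assumes "f0 \<in> N" "g0 \<in> N" "h0 \<in> N" "det3 f0 g0 h0 \<noteq> 0"
  obtains a b c where "norm a = 1" "norm b = 1" "norm c = 1" "det3 a b c \<noteq> 0" "chamber N (ocone a b c)"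
proof -
  let ?C = open_dual_cone
  define \<T> where "\<T> = {(f, g, h). f \<in> N \<and> g \<in> N \<and> h \<in> N \<and> det3 f g h \<noteq> 0}"
  have "\<T> \<subseteq> N \<times> N \<times> N"
    by (auto simp: \<T>_def)
  then have "finite (?C ` \<T>)"
    using finite_N by (meson finite_SigmaI finite_imageI finite_subset)
  moreover have "?C ` \<T> \<noteq> {}"
    using assms by (auto simp: \<T>_def)
  ultimately obtain K where K: "K \<in> ?C ` \<T>" "\<And>L. L \<in> ?C ` \<T> \<Longrightarrow> L \<subseteq> K \<Longrightarrow> L = K"
    using finite_has_minimal[of "?C ` \<T>"] by blast
  \<comment> \<open>As \<open>f\<close> is a nonnegative combination of \<open>n\<close>,
    \<open>g\<close>, \<open>h\<close>, replacing \<open>f\<close> by \<open>n\<close> gives a cone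
    inside \<open>K\<close>; by minimality it equals \<open>K\<close>.\<close>
  have cut: False
    if T: "(f, g, h) \<in> \<T>" "?C (f, g, h) = K" and n: "n \<in> N" "n = r *\<^sub>R f + s *\<^sub>R g + t *\<^sub>R h"
      and sgn: "0 < r" "s < 0" "t \<le> 0" for f g h n r s t
  proof -
    have N: "f \<in> N" "g \<in> N" "h \<in> N" and d: "det3 f g h \<noteq> 0"
      using T by (auto simp: \<T>_def)
    have "det3 n g h = r * det3 f g h"
      unfolding n(2) det3_components by (simp add: algebra_simps)
    then have "(n, g, h) \<in> \<T>"
      using N n d sgn by (simp add: \<T>_def)
    moreover have "?C (n, g, h) \<subseteq> K"
    proof
      fix y assume y: "y \<in> ?C (n, g, h)"
      then have y': "0 < n \<bullet> y" "0 < g \<bullet> y" "0 < h \<bullet> y"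
        by (auto simp: open_dual_cone_def)
      have "n \<bullet> y = r * (f \<bullet> y) + s * (g \<bullet> y) + t * (h \<bullet> y)"
        unfolding n(2) by (simp add: inner_add_left)
      moreover have "s * (g \<bullet> y) \<le> 0" "t * (h \<bullet> y) \<le> 0"
        using y' sgn by (auto simp: mult_le_0_iff)
      ultimately have "0 < r * (f \<bullet> y)"
        using y' by linarith
      then show "y \<in> K"
        using y' sgn T(2) by (auto simp: open_dual_cone_def zero_less_mult_iff)
    qed
    ultimately have eq: "?C (n, g, h) = K"
      using K(2) by blast
    obtain a b c where dual: "\<And>r s t. f \<bullet> (r *\<^sub>R a + s *\<^sub>R b + t *\<^sub>R c) = r"
      "\<And>r s t. g \<bullet> (r *\<^sub>R a + s *\<^sub>R b + t *\<^sub>R c) = s" "\<And>r s t. h \<bullet> (r *\<^sub>R a + s *\<^sub>R b + t *\<^sub>R c) = t"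
      using det3_dual_basis[OF d] by metis
    \<comment> \<open>The dual coordinates are chosen so that the contributions of \<open>f\<close>
      and \<open>g\<close> to \<open>n \<bullet> y\<close> cancel, leaving t \<le> 0.\<close>
    define y where "y = 1 *\<^sub>R a + (r / (- s)) *\<^sub>R b + 1 *\<^sub>R c"
    have fy: "f \<bullet> y = 1" "g \<bullet> y = r / (- s)" "h \<bullet> y = 1"
      unfolding y_def by (rule dual)+
    have "0 < r / (- s)"
      using sgn by (intro divide_pos_pos) auto
    then have "y \<in> K"
      using fy T(2) by (auto simp: open_dual_cone_def)
    then have "0 < n \<bullet> y"
      using eq by (auto simp: open_dual_cone_def)
    moreover have "n \<bullet> y = t"
      unfolding n(2) using sgn by (simp add: inner_add_left fy)
    ultimately show False
      using sgn by simp
  qed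
  obtain f g h where T: "(f, g, h) \<in> \<T>" "?C (f, g, h) = K"
    using K(1) by auto
  then have N: "f \<in> N" "g \<in> N" "h \<in> N" and d: "det3 f g h \<noteq> 0"
    by (auto simp: \<T>_def)
  have mixed: False
    if T: "(f, g, h) \<in> \<T>" "?C (f, g, h) = K" and n: "n \<in> N" "n = r *\<^sub>R f + s *\<^sub>R g + t *\<^sub>R h"
      and sgn: "0 < r" "s < 0" for f g h n r s t
  proof (cases "t \<le> 0")
    case True
    then show False
      using cut[OF T n sgn] by blast
  next
    case False
    \<comment> \<open>For t > 0, \<open>- n\<close> with \<open>f\<close> and \<open>g\<close>
      exchanged has the sign pattern required by \<open>cut\<close>.\<close>
    have "(g, f, h) \<in> \<T>" "?C (g, f, h) = K"
      using T det3_eq_0_iff_swap(1)[of g f h] by (auto simp: \<T>_def open_dual_cone_def)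
    moreover have "- n \<in> N" "- n = (- s) *\<^sub>R g + (- r) *\<^sub>R f + (- t) *\<^sub>R h"
      using uminus_N[OF n(1)] by (simp_all add: n(2))
    ultimately show False
      by (rule cut) (use sgn False in auto)
  qed
  have perm: "(f, h, g) \<in> \<T>" "?C (f, h, g) = K" "(g, h, f) \<in> \<T>" "?C (g, h, f) = K"
    "(g, f, h) \<in> \<T>" "?C (g, f, h) = K" "(h, f, g) \<in> \<T>" "?C (h, f, g) = K"
    "(h, g, f) \<in> \<T>" "?C (h, g, f) = K"
    using T det3_eq_0_iff_swap by (auto simp: \<T>_def open_dual_cone_def)
  obtain a b c where dabc: "det3 a b c \<noteq> 0"
    and e: "\<And>y. y = (f \<bullet> y) *\<^sub>R a + (g \<bullet> y) *\<^sub>R b + (h \<bullet> y) *\<^sub>R c"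
    and dual: "\<And>r s t. f \<bullet> (r *\<^sub>R a + s *\<^sub>R b + t *\<^sub>R c) = r"
      "\<And>r s t. g \<bullet> (r *\<^sub>R a + s *\<^sub>R b + t *\<^sub>R c) = s" "\<And>r s t. h \<bullet> (r *\<^sub>R a + s *\<^sub>R b + t *\<^sub>R c) = t"
    by (rule det3_dual_basis[OF d]) (rule that)
  have K_ocone: "K = ocone a b c"
  proof (intro equalityI subsetI)
    fix y assume "y \<in> K"
    then have "0 < f \<bullet> y" "0 < g \<bullet> y" "0 < h \<bullet> y"
      using T(2) by (auto simp: open_dual_cone_def)
    then show "y \<in> ocone a b c"
      by (subst e) (rule ocone_memI)
  next
    fix y assume "y \<in> ocone a b c"
    then show "y \<in> K"
      unfolding ocone_def T(2)[symmetric] by (auto simp: open_dual_cone_def dual)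
  qed
  \<comment> \<open>With mixed signs excluded, the coefficients of \<open>n\<close> in
    \<open>f\<close>, \<open>g\<close>, \<open>h\<close> have one sign, so \<open>n\<close> has
    constant sign on \<open>K\<close>.\<close>
  have sign: "0 < (n \<bullet> x) * (n \<bullet> y)" if n: "n \<in> N" and xy: "x \<in> K" "y \<in> K" for n x y
  proof -
    obtain r s t where nc: "n = r *\<^sub>R f + s *\<^sub>R g + t *\<^sub>R h"
      by (rule det3_coordinates[OF d])
    have "\<not> (0 < r \<and> s < 0)" "\<not> (0 < s \<and> r < 0)" "\<not> (0 < r \<and> t < 0)" "\<not> (0 < t \<and> r < 0)"
      "\<not> (0 < s \<and> t < 0)" "\<not> (0 < t \<and> s < 0)"
      using mixed[OF T n, of r s t] mixed[OF perm(5,6) n, of s r t] mixed[OF perm(1,2) n, of r t s]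
        mixed[OF perm(7,8) n, of t r s] mixed[OF perm(3,4) n, of s t r] mixed[OF perm(9,10) n, of t s r]
      by (auto simp: nc add_ac)
    moreover have "r \<noteq> 0 \<or> s \<noteq> 0 \<or> t \<noteq> 0"
      using nc norm_N[OF n] by auto
    moreover have p: "0 < f \<bullet> x" "0 < g \<bullet> x" "0 < h \<bullet> x" "0 < f \<bullet> y" "0 < g \<bullet> y" "0 < h \<bullet> y"
      using xy T(2) by (auto simp: open_dual_cone_def)
    ultimately consider "0 \<le> r" "0 \<le> s" "0 \<le> t" "0 < r \<or> 0 < s \<or> 0 < t"
      | "r \<le> 0" "s \<le> 0" "t \<le> 0" "r < 0 \<or> s < 0 \<or> t < 0"
      by linarith
    then show ?thesis
    proof cases
      case 1
      have "0 < n \<bullet> z" if "0 < f \<bullet> z" "0 < g \<bullet> z" "0 < h \<bullet> z" for z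
      proof -
        have "0 \<le> r * (f \<bullet> z)" "0 \<le> s * (g \<bullet> z)" "0 \<le> t * (h \<bullet> z)"
          "0 < r * (f \<bullet> z) \<or> 0 < s * (g \<bullet> z) \<or> 0 < t * (h \<bullet> z)"
          using 1 that by (auto simp: zero_less_mult_iff)
        then show ?thesis
          unfolding nc inner_add_left inner_scaleR_left by linarith
      qed
      then show ?thesis
        using p by (intro mult_pos_pos) blast+
    next
      case 2
      have "n \<bullet> z < 0" if "0 < f \<bullet> z" "0 < g \<bullet> z" "0 < h \<bullet> z" for z
      proof -
        have "r * (f \<bullet> z) \<le> 0" "s * (g \<bullet> z) \<le> 0" "t * (h \<bullet> z) \<le> 0"
          "r * (f \<bullet> z) < 0 \<or> s * (g \<bullet> z) < 0 \<or> t * (h \<bullet> z) < 0"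
          using 2 that by (auto simp: mult_less_0_iff mult_le_0_iff)
        then show ?thesis
          unfolding nc inner_add_left inner_scaleR_left by linarith
      qed
      then show ?thesis
        using p by (intro mult_neg_neg) blast+
    qed
  qed
  define x where "x = 1 *\<^sub>R a + 1 *\<^sub>R b + 1 *\<^sub>R c"
  have x: "x \<in> K"
    unfolding x_def K_ocone by (rule ocone_memI) simp_all
  have "K = cell N x"
  proof (intro equalityI subsetI)
    fix y assume "y \<in> K"
    then show "y \<in> cell N x"
      unfolding cell_def using sign x by blast
  next
    fix y assume y: "y \<in> cell N x"
    have "0 < f \<bullet> x" "0 < g \<bullet> x" "0 < h \<bullet> x"
      using x T(2) by (auto simp: open_dual_cone_def)
    then show "y \<in> K"
      using y N unfolding cell_def T(2)[symmetric] by (auto simp: open_dual_cone_def zero_less_mult_iff)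
  qed
  then have ch: "chamber N (ocone a b c)"
    unfolding chamber_def using x K_ocone by blast
  have nz: "0 < 1 / norm a" "0 < 1 / norm b" "0 < 1 / norm c"
    using dabc by (auto simp: det3_components)
  show ?thesis
  proof
    show "det3 ((1 / norm a) *\<^sub>R a) ((1 / norm b) *\<^sub>R b) ((1 / norm c) *\<^sub>R c) \<noteq> 0"
      unfolding det3_scale using nz dabc by auto
    show "chamber N (ocone ((1 / norm a) *\<^sub>R a) ((1 / norm b) *\<^sub>R b) ((1 / norm c) *\<^sub>R c))"
      using ch by (simp only: ocone_scale[OF nz])
  qed (use nz in auto)
qed

text \<open>Orthogonal maps carry the one simplicial chamber, with its vertices and their inner
  products, to all chambers, so one multiset serves them all.\<close>

lemma (in unit_normals) essential_reflection_closed: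
  assumes "f0 \<in> N" "g0 \<in> N" "h0 \<in> N" "det3 f0 g0 h0 \<noteq> 0"
    and iso: "\<And>x y. x \<in> cell N x \<Longrightarrow> y \<in> cell N y \<Longrightarrow>
      \<exists>U. orthogonal_transformation U \<and> U ` cell N x = cell N y"
    and nm: "n \<in> N" "m \<in> N"
  shows "reflection_along n m \<in> N"
proof -
  obtain a b c where T: "norm a = 1" "norm b = 1" "norm c = 1" "det3 a b c \<noteq> 0" "chamber N (ocone a b c)"
    using exists_simplicial_chamber[OF assms(1-4)] by metis
  then obtain x where x: "x \<in> cell N x" "ocone a b c = cell N x"
    unfolding chamber_def by blast
  interpret congruent_simplicial N "{#b \<bullet> c, a \<bullet> c, a \<bullet> b#}"
  proof
    fix y assume y: "y \<in> cell N y"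
    obtain U where U: "orthogonal_transformation U" "U ` cell N x = cell N y"
      using iso[OF x(1) y] by blast
    have "cell N y = ocone (U a) (U b) (U c)"
      using U x(2) ocone_linear_image[OF orthogonal_transformation_linear[OF U(1)]] by metis
    moreover have "det3 (U a) (U b) (U c) \<noteq> 0"
      using det3_orthogonal_transformation[OF U(1), of a b c] T(4) by auto
    moreover have "norm (U z) = norm z" "U z \<bullet> U w = z \<bullet> w" for z w
      using U(1) orthogonal_transformation_norm[OF U(1)] by (auto simp: orthogonal_transformation_def)
    ultimately show "\<exists>a' b' c'. cell N y = ocone a' b' c' \<and> norm a' = 1 \<and> norm b' = 1 \<and> norm c' = 1 \<and>
        det3 a' b' c' \<noteq> 0 \<and> {#b' \<bullet> c', a' \<bullet> c', a' \<bullet> b'#} = {#b \<bullet> c, a \<bullet> c, a \<bullet> b#}"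
      using T by (intro exI[of _ "U a"] exI[of _ "U b"] exI[of _ "U c"]) simp
  qed
  show ?thesis
    by (rule reflection_N[OF nm])
qed

section \<open>Reflection-closed sets of normals\<close>

lemma reflection_along_scale:
  assumes "k \<noteq> 0"
  shows "reflection_along (k *\<^sub>R v) = reflection_along v"
  using assms by (simp add: reflection_along_def fun_eq_iff)

lemma det_matrix_reflection_along:
  fixes n :: "real^3"
  assumes "norm n = 1"
  shows "det (matrix (reflection_along n)) = - 1"
proof -
  have n2: "n$1 * n$1 + n$2 * n$2 + n$3 * n$3 = 1"
    using assms by (simp add: norm_eq_1 inner_vec_def sum_3)
  have e: "matrix (reflection_along n) $ i $ j = (if i = j then 1 else 0) - 2 * (n$j) * (n$i)" for i j
    by (simp add: matrix_def reflection_along_unit[OF assms] inner_axis) (simp add: axis_def)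
  have ne: "(1::3) \<noteq> 2" "(1::3) \<noteq> 3" "(2::3) \<noteq> 3" "(2::3) \<noteq> 1" "(3::3) \<noteq> 1" "(3::3) \<noteq> 2"
    by simp_all
  have "det (matrix (reflection_along n)) = 1 - 2 * (n$1 * n$1 + n$2 * n$2 + n$3 * n$3)"
    unfolding det_3 e by (simp only: ne if_False if_True simp_thms) algebra
  then show ?thesis
    using n2 by simp
qed

lemma BijGroup_UNIV_simps:
  "carrier (BijGroup UNIV) = {f. bij f}"
  "\<one>\<^bsub>BijGroup UNIV\<^esub> = id"
  "bij f \<Longrightarrow> bij g \<Longrightarrow> f \<otimes>\<^bsub>BijGroup UNIV\<^esub> g = f \<circ> g"
  by (auto simp: BijGroup_def Bij_def extensional_def compose_def fun_eq_iff restrict_def)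

section \<open>Positive systems and the generated group\<close>

context unit_normals
begin

lemma positive_system:
  obtains P where "P \<subseteq> N" "\<And>n. n \<in> N \<Longrightarrow> n \<in> P \<or> - n \<in> P" "\<And>n. n \<in> P \<Longrightarrow> - n \<notin> P"
proof -
  have "\<exists>x\<in>UNIV. n \<bullet> x \<noteq> 0" if "n \<in> N" for n
    using norm_N[OF that] by (intro bexI[of _ n]) auto
  then obtain x where x: "\<And>n. n \<in> N \<Longrightarrow> n \<bullet> x \<noteq> 0"
    using subspace_avoids_hyperplanes[of N UNIV] finite_N by (metis subspace_UNIV)
  show ?thesis
  proof
    show "{n \<in> N. 0 < n \<bullet> x} \<subseteq> N"
      by blast
    show "n \<in> {n \<in> N. 0 < n \<bullet> x} \<or> - n \<in> {n \<in> N. 0 < n \<bullet> x}" if "n \<in> N" for n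
      using x[OF that] uminus_N[OF that] that by auto
    show "- n \<notin> {n \<in> N. 0 < n \<bullet> x}" if "n \<in> {n \<in> N. 0 < n \<bullet> x}" for n
      using that by auto
  qed
qed

text \<open>The reflection permutes the positive normals up to sign, and \<open>n\<close> itself
  contributes -1. The signs of the others need not be tracked one by one, since their product can be
  read off at a single point.\<close>

lemma reflection_negates_product:
  assumes closed: "\<And>n m. n \<in> N \<Longrightarrow> m \<in> N \<Longrightarrow> reflection_along n m \<in> N"
    and P: "P \<subseteq> N" "\<And>n. n \<in> N \<Longrightarrow> n \<in> P \<or> - n \<in> P" "\<And>n. n \<in> P \<Longrightarrow> - n \<notin> P"
    and n: "n \<in> P"
  shows "(\<Prod>m\<in>P. m \<bullet> reflection_along n x) = - (\<Prod>m\<in>P. m \<bullet> x)"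
proof -
  let ?s = "reflection_along n"
  have nN: "n \<in> N" and n1: "norm n = 1"
    using n P(1) norm_N by auto
  have "n \<noteq> 0"
    using n1 by auto
  then have orth: "orthogonal_transformation ?s"
    by (rule orthogonal_transformation_reflection_along)
  have sn: "?s n = - n"
    using n1 by (simp add: reflection_along_unit norm_eq_1 scaleR_2)
  have inv: "?s (?s y) = y" for y
    by (rule reflection_along_involution)
  have s_minus: "?s (- y) = - ?s y" for y
    by (simp add: reflection_along_def)
  have swap: "m \<bullet> ?s y = ?s m \<bullet> y" for m y
    using orth inv unfolding orthogonal_transformation_def by metis
  define Q where "Q = P - {n}"
  have finQ: "finite Q" "finite P"
    using finite_N P(1) by (auto simp: Q_def intro: finite_subset)
  define \<epsilon> where "\<epsilon> m = (if ?s m \<in> P then 1 else - 1 :: real)" for m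
  define \<pi> where "\<pi> m = (if ?s m \<in> P then ?s m else - ?s m)" for m
  have eps: "m \<bullet> ?s y = \<epsilon> m * (\<pi> m \<bullet> y)" for m y
    by (simp add: swap \<epsilon>_def \<pi>_def)
  have \<pi>P: "\<pi> m \<in> P" if "m \<in> P" for m
    using P(2)[of "?s m"] closed[OF nN] that P(1) by (auto simp: \<pi>_def)
  have \<pi>s: "m = ?s (\<pi> m) \<or> m = - ?s (\<pi> m)" for m
    by (auto simp: \<pi>_def inv s_minus)
  have "inj_on \<pi> Q"
  proof (rule inj_onI)
    fix m m' assume m: "m \<in> Q" "m' \<in> Q" "\<pi> m = \<pi> m'"
    then have "m = m' \<or> m = - m'"
      using \<pi>s[of m] \<pi>s[of m'] by (metis minus_minus)
    then show "m = m'"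
      using m P(3)[of m'] by (auto simp: Q_def)
  qed
  moreover have "\<pi> ` Q \<subseteq> Q"
  proof
    fix k assume "k \<in> \<pi> ` Q"
    then obtain m where m: "m \<in> P" "m \<noteq> n" "k = \<pi> m"
      by (auto simp: Q_def)
    have "k \<noteq> n"
    proof
      assume "k = n"
      then have "m = n \<or> m = - n"
        using \<pi>s[of m] m by (auto simp: sn)
      then show False
        using m P(3)[OF n] by auto
    qed
    then show "k \<in> Q"
      using m \<pi>P by (simp add: Q_def)
  qed
  ultimately have bij: "bij_betw \<pi> Q Q"
    using finQ(1) by (simp add: bij_betw_def endo_inj_surj)
  define E where "E = (\<Prod>m\<in>Q. \<epsilon> m)"
  have Q: "(\<Prod>m\<in>Q. m \<bullet> ?s y) = E * (\<Prod>m\<in>Q. m \<bullet> y)" for y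
  proof -
    have "(\<Prod>m\<in>Q. m \<bullet> ?s y) = E * (\<Prod>m\<in>Q. \<pi> m \<bullet> y)"
      unfolding eps prod.distrib E_def ..
    also have "(\<Prod>m\<in>Q. \<pi> m \<bullet> y) = (\<Prod>m\<in>Q. m \<bullet> y)"
      by (rule prod.reindex_bij_betw[OF bij])
    finally show ?thesis .
  qed
  \<comment> \<open>At a fixed point of the reflection lying on no other plane, the remaining
    product is nonzero and unchanged, so \<open>E\<close> = 1.\<close>
  have "\<exists>y\<in>{y. n \<bullet> y = 0}. m \<bullet> y \<noteq> 0" if "m \<in> Q" for m
  proof -
    have "m \<noteq> n" "m \<noteq> - n" "norm m = 1"
      using that P(3)[OF n] P(1) norm_N by (auto simp: Q_def)
    then show ?thesis
      using unit_hyperplane_unique[of m n] n1 by auto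
  qed
  then obtain y where y: "n \<bullet> y = 0" "\<And>m. m \<in> Q \<Longrightarrow> m \<bullet> y \<noteq> 0"
    using subspace_avoids_hyperplanes[of Q "{y. n \<bullet> y = 0}"] finQ(1) subspace_hyperplane[of n] by blast
  have "?s y = y"
    using y(1) by (simp add: reflection_along_def)
  moreover have "(\<Prod>m\<in>Q. m \<bullet> y) \<noteq> 0"
    using y(2) finQ by simp
  ultimately have "E = 1"
    using Q[of y] by simp
  have split: "(\<Prod>m\<in>P. m \<bullet> z) = (n \<bullet> z) * (\<Prod>m\<in>Q. m \<bullet> z)" for z
    unfolding Q_def using finQ(2) n by (rule prod.remove)
  show ?thesis
    unfolding split Q \<open>E = 1\<close> swap[of n] sn by simp
qed

text \<open>The product of the linear forms of a positive system is multiplied by the determinant under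
  the group, so it vanishes on the mirror of every reflection of the group.\<close>

lemma closed_imp_coxeter:
  assumes closed: "\<And>n m. n \<in> N \<Longrightarrow> m \<in> N \<Longrightarrow> reflection_along n m \<in> N"
  shows "coxeter_arrangement ((\<lambda>n. {x. n \<bullet> x = 0}) ` N)"
proof -
  obtain P where P: "P \<subseteq> N" "\<And>n. n \<in> N \<Longrightarrow> n \<in> P \<or> - n \<in> P" "\<And>n. n \<in> P \<Longrightarrow> - n \<notin> P"
    using positive_system by metis
  have finP: "finite P"
    using P(1) finite_N by (rule finite_subset)
  define F where "F x = (\<Prod>m\<in>P. m \<bullet> x)" for x
  define S where "S = reflection_along ` N"
  define W where "W = generate (BijGroup UNIV) S"
  \<comment> \<open>Properties stable under composition. Linearity, the action on \<open>N\<close>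
    and the trivial action on its orthogonal complement give finiteness; the determinant rule
    controls the mirrors.\<close>
  define good where "good w \<longleftrightarrow> orthogonal_transformation w \<and> w ` N \<subseteq> N \<and>
      (\<forall>x. (\<forall>n\<in>N. n \<bullet> x = 0) \<longrightarrow> w x = x) \<and> (\<forall>x. F (w x) = det (matrix w) * F x)" for w
  have nz: "n \<noteq> 0" if "n \<in> N" for n
    using norm_N[OF that] by auto
  have S_refl: "is_reflection s" if "s \<in> S" for s
    using that nz by (auto simp: S_def is_reflection_def)
  have good_refl: "good s" if s: "s \<in> S" for s
  proof -
    obtain n where n: "n \<in> N" "s = reflection_along n"
      using s by (auto simp: S_def)
    obtain n' where n': "n' \<in> P" "s = reflection_along n'"
      using P(2)[OF n(1)] n(2) reflection_along_uminus by metis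
    have "F (s x) = - F x" for x
      unfolding F_def n'(2) by (rule reflection_negates_product[OF closed P n'(1)])
    moreover have "det (matrix s) = - 1"
      unfolding n(2) by (rule det_matrix_reflection_along[OF norm_N[OF n(1)]])
    ultimately show ?thesis
      using closed n orthogonal_transformation_reflection_along[OF nz[OF n(1)]]
      by (auto simp: good_def) (simp add: reflection_along_def)
  qed
  have good_comp: "good (f \<circ> g)" if "good f" "good g" for f g
    using that matrix_compose[of g f] unfolding good_def
    by (auto simp: orthogonal_transformation_compose det_mul orthogonal_transformation_linear image_subset_iff)
  have good_id: "good id"
    by (simp add: good_def orthogonal_transformation_id[unfolded id_def[symmetric]] matrix_id)
  have grp: "group (BijGroup (UNIV :: (real^3) set))"
    by (rule group_BijGroup)
  have good_bij: "bij f" if "good f" for f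
    using that orthogonal_transformation_bij by (auto simp: good_def)
  have inv_S: "inv\<^bsub>BijGroup UNIV\<^esub> s = s" if "s \<in> S" for s
  proof (rule group.inv_equality[OF grp])
    have "s \<circ> s = id"
      using that reflection_along_involution by (auto simp: S_def fun_eq_iff)
    then show "s \<otimes>\<^bsub>BijGroup UNIV\<^esub> s = \<one>\<^bsub>BijGroup UNIV\<^esub>"
      using good_bij[OF good_refl[OF that]] by (simp add: BijGroup_UNIV_simps)
  qed (use good_bij[OF good_refl[OF that]] in \<open>simp_all add: BijGroup_UNIV_simps\<close>)
  have good_W: "good w" if "w \<in> W" for w
    using that unfolding W_def
  proof (induction rule: generate.induct)
    case one
    then show ?case
      unfolding BijGroup_UNIV_simps by (rule good_id)
  next
    case (incl h)
    then show ?case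
      by (rule good_refl)
  next
    case (inv h)
    then show ?case
      using inv_S good_refl by simp
  next
    case (eng h1 h2)
    then show ?case
      using good_comp by (simp only: BijGroup_UNIV_simps(3) good_bij)
  qed
  have "finite W"
  proof -
    \<comment> \<open>An element is determined on the span of \<open>N\<close> by its values on
      \<open>N\<close>, and it is the identity on the orthogonal complement.\<close>
    have "inj_on (\<lambda>w. restrict w N) W"
    proof (rule inj_onI)
      fix w w' assume w: "w \<in> W" "w' \<in> W" "restrict w N = restrict w' N"
      have lin: "linear w" "linear w'"
        using good_W w by (auto simp: good_def orthogonal_transformation_linear)
      have eqN: "w x = w' x" if "x \<in> N" for x
        using w(3) that by (metis restrict_apply')
      show "w = w'"
      proof
        fix x
        obtain y z where yz: "y \<in> span N" "\<And>u. u \<in> span N \<Longrightarrow> orthogonal z u" "x = y + z"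
          using orthogonal_subspace_decomp_exists[of N x] by metis
        have "w y = w' y"
          by (rule linear_eq_on[OF lin yz(1)]) (rule eqN)
        moreover have "\<forall>n\<in>N. n \<bullet> z = 0"
          using yz(2) by (metis inner_commute orthogonal_def span_base)
        then have "w z = z" "w' z = z"
          using good_W w by (auto simp: good_def)
        ultimately show "w x = w' x"
          using lin by (simp add: yz(3) linear_add)
      qed
    qed
    moreover have "(\<lambda>w. restrict w N) ` W \<subseteq> N \<rightarrow>\<^sub>E N"
      using good_W by (fastforce simp: good_def)
    moreover have "finite (N \<rightarrow>\<^sub>E N)"
      using finite_N by (intro finite_PiE) auto
    ultimately show ?thesis
      by (metis finite_imageD finite_subset)
  qed
  then have "finite_reflection_group W"
    unfolding finite_reflection_group_def W_def using S_refl by blast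
  moreover have "(\<lambda>n. {x. n \<bullet> x = 0}) ` N = mirror ` {s \<in> W. is_reflection s}"
  proof (intro equalityI subsetI)
    fix H assume "H \<in> (\<lambda>n. {x. n \<bullet> x = 0}) ` N"
    then obtain n where n: "n \<in> N" "H = {x. n \<bullet> x = 0}"
      by blast
    have "reflection_along n \<in> S"
      using n by (simp add: S_def)
    then have "reflection_along n \<in> W" "is_reflection (reflection_along n)"
      using S_refl unfolding W_def by (auto intro: generate.incl)
    moreover have "H = mirror (reflection_along n)"
      using mirror_reflection_along[OF nz[OF n(1)]] n(2) by simp
    ultimately show "H \<in> mirror ` {s \<in> W. is_reflection s}"
      by blast
  next
    fix H assume "H \<in> mirror ` {s \<in> W. is_reflection s}"
    then obtain s where s: "s \<in> W" "is_reflection s" "H = mirror s"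
      by blast
    obtain v0 where v0: "v0 \<noteq> 0" "s = reflection_along v0"
      using s(2) by (auto simp: is_reflection_def)
    define v where "v = (1 / norm v0) *\<^sub>R v0"
    have v: "norm v = 1" "v \<noteq> 0" "s = reflection_along v"
      using v0 reflection_along_scale[of "1 / norm v0" v0] by (auto simp: v_def)
    have H: "H = {x. v \<bullet> x = 0}"
      unfolding s(3) v(3) by (rule mirror_reflection_along[OF v(2)])
    \<comment> \<open>If no factor of \<open>F\<close> vanished on the mirror, a point of it would
      avoid all planes, because a subspace is not a finite union of proper subspaces.\<close>
    have "\<exists>n\<in>P. \<forall>x. v \<bullet> x = 0 \<longrightarrow> n \<bullet> x = 0"
    proof (rule ccontr)
      assume "\<not> ?thesis"
      then have "\<exists>x\<in>{x. v \<bullet> x = 0}. n \<bullet> x \<noteq> 0" if "n \<in> P" for n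
        using that by blast
      then obtain x where x: "v \<bullet> x = 0" "\<And>n. n \<in> P \<Longrightarrow> n \<bullet> x \<noteq> 0"
        using subspace_avoids_hyperplanes[of P "{x. v \<bullet> x = 0}"] finP subspace_hyperplane[of v] by blast
      have "s x = x"
        using x(1) by (simp add: v(3) reflection_along_def)
      moreover have "F (s x) = - F x"
        using good_W[OF s(1)] det_matrix_reflection_along[OF v(1)] by (simp add: good_def v(3))
      ultimately have "F x = 0"
        by simp
      then show False
        using x(2) finP by (auto simp: F_def)
    qed
    then obtain n where n: "n \<in> P" "\<And>x. v \<bullet> x = 0 \<Longrightarrow> n \<bullet> x = 0"
      by blast
    have "n \<in> N"
      using n(1) P(1) by blast
    moreover have "n = v \<or> n = - v"
      using unit_hyperplane_unique[OF norm_N[OF \<open>n \<in> N\<close>] v(1) n(2)] by blast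
    then have "H = {x. n \<bullet> x = 0}"
      using H by auto
    ultimately show "H \<in> (\<lambda>n. {x. n \<bullet> x = 0}) ` N"
      by blast
  qed
  ultimately show ?thesis
    unfolding coxeter_arrangement_def by blast
qed

end

section \<open>Regions and isometries\<close>

text \<open>Applying the affine map to large multiples and scaling back makes the translation
  negligible, so \<open>U\<close> maps into the closure of \<open>R'\<close>. The image is open, and
  an open convex set is the interior of its closure.\<close>

lemma cone_isometry_linear_part:
  fixes R R' :: "'a::euclidean_space set"
  assumes "open R" "convex R'" "open R'"
    and cone: "\<And>s x. 0 < s \<Longrightarrow> x \<in> R \<Longrightarrow> s *\<^sub>R x \<in> R" "\<And>s x. 0 < s \<Longrightarrow> x \<in> R' \<Longrightarrow> s *\<^sub>R x \<in> R'"
    and U: "orthogonal_transformation U" and f: "\<And>x. x \<in> R \<Longrightarrow> b + U x \<in> R'"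
  shows "U ` R \<subseteq> R'"
proof -
  have lin: "linear U"
    using U by (rule orthogonal_transformation_linear)
  have "U ` R \<subseteq> closure R'"
  proof
    fix z assume "z \<in> U ` R"
    then obtain y where y: "y \<in> R" "z = U y"
      by blast
    have mem: "inverse (real (Suc k)) *\<^sub>R b + U y \<in> R'" for k
    proof -
      have "b + U (real (Suc k) *\<^sub>R y) \<in> R'"
        using y by (intro f cone(1)) auto
      then have "inverse (real (Suc k)) *\<^sub>R (b + U (real (Suc k) *\<^sub>R y)) \<in> R'"
        by (intro cone(2)) auto
      then show ?thesis
        by (simp add: linear_scale[OF lin] scaleR_add_right del: of_nat_Suc)
    qed
    have "(\<lambda>k. inverse (real (Suc k)) *\<^sub>R b + U y) \<longlonglongrightarrow> 0 *\<^sub>R b + U y"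
      by (intro tendsto_intros LIMSEQ_inverse_real_of_nat)
    also have "0 *\<^sub>R b + U y = z"
      using y(2) by simp
    finally have "(\<lambda>k. inverse (real (Suc k)) *\<^sub>R b + U y) \<longlonglongrightarrow> z" .
    then show "z \<in> closure R'"
      unfolding closure_sequential
      by (intro exI[of _ "\<lambda>k. inverse (real (Suc k)) *\<^sub>R b + U y"] conjI allI mem)
  qed
  moreover have "open (U ` R)"
    using open_surjective_linear_image[OF assms(1) lin] orthogonal_transformation_surj[OF U] by blast
  ultimately have "U ` R \<subseteq> interior (closure R')"
    by (rule interior_maximal)
  also have "\<dots> = R'"
    using convex_interior_closure[OF assms(2)] interior_open[OF assms(3)] by simp
  finally show ?thesis .
qed

text \<open>The linear parts of the isometry and of its inverse are inverse to each other, so the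
  two inclusions give equality.\<close>

lemma isometric_cones:
  fixes R R' :: "'a::euclidean_space set"
  assumes R: "open R" "convex R" "\<And>s x. 0 < s \<Longrightarrow> x \<in> R \<Longrightarrow> s *\<^sub>R x \<in> R"
    and R': "open R'" "convex R'" "\<And>s x. 0 < s \<Longrightarrow> x \<in> R' \<Longrightarrow> s *\<^sub>R x \<in> R'"
    and f: "euclidean_isometry f" "f ` R = R'"
  obtains U where "orthogonal_transformation U" "U ` R = R'"
proof -
  have bij: "bij f" and dist: "\<And>x y. dist (f x) (f y) = dist x y"
    using f(1) by (auto simp: euclidean_isometry_def)
  define g where "g = inv_into UNIV f"
  have fg: "f (g x) = x" and gf: "g (f x) = x" for x
    using bij by (simp_all add: g_def bij_is_surj surj_f_inv_f bij_is_inj)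
  have dist': "dist (g x) (g y) = dist x y" for x y
    using dist[of "g x" "g y"] by (simp add: fg)
  define U V where UV: "U x = f x - f 0" "V x = g x - g 0" for x
  have U: "orthogonal_transformation U"
    using dist by (simp add: orthogonal_transformation_isometry UV dist_norm)
  have V: "orthogonal_transformation V"
    using dist' by (simp add: orthogonal_transformation_isometry UV dist_norm)
  have "U ` R \<subseteq> R'"
    using f(2) by (intro cone_isometry_linear_part[OF R(1) R'(2,1) R(3) R'(3) U, of "f 0"]) (auto simp: UV)
  moreover have "V ` R' \<subseteq> R"
    using f(2) gf by (intro cone_isometry_linear_part[OF R'(1) R(2,1) R'(3) R(3) V, of "g 0"]) (auto simp: UV)
  moreover have "U (V x) = x" for x
  proof -
    have "U (V x) = U (g x) - U (g 0)"
      unfolding UV(2) by (rule linear_diff[OF orthogonal_transformation_linear[OF U]])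
    then show ?thesis
      by (simp add: UV fg)
  qed
  ultimately have "U ` R = R'"
    by (metis image_subset_iff imageI subsetI subset_antisym)
  then show ?thesis
    using that U by blast
qed

section \<open>Cells as regions\<close>

lemma open_cell:
  fixes N :: "'a::euclidean_space set"
  assumes "finite N"
  shows "open (cell N x)"
proof -
  have "cell N x = (\<Inter>n\<in>N. {y. 0 < (n \<bullet> x) * (n \<bullet> y)})"
    by (auto simp: cell_def)
  moreover have "open {y. 0 < (n \<bullet> x) * (n \<bullet> y)}" for n
    by (intro open_Collect_less continuous_intros)
  ultimately show ?thesis
    using assms by auto
qed

lemma convex_cell: "convex (cell N x)"
proof -
  have "cell N x = (\<Inter>n\<in>N. {y. ((n \<bullet> x) *\<^sub>R n) \<bullet> y > 0})"
    by (auto simp: cell_def)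
  then show ?thesis
    by (simp only: convex_INT convex_halfspace_gt)
qed

lemma cell_scaleR: "0 < s \<Longrightarrow> y \<in> cell N x \<Longrightarrow> s *\<^sub>R y \<in> cell N x"
  by (simp add: cell_def mult.left_commute[of _ s])

text \<open>A cell is convex, hence connected; a connected set avoiding the planes cannot change
  sides of any of them, by the intermediate value theorem.\<close>

lemma cell_in_regions:
  fixes N :: "'a::euclidean_space set"
  assumes x: "x \<in> cell N x"
  shows "cell N x \<in> regions ((\<lambda>n. {x. n \<bullet> x = 0}) ` N)"
proof -
  define S where "S = UNIV - \<Union> ((\<lambda>n. {x. n \<bullet> x = 0}) ` N)"
  have S: "y \<in> S \<longleftrightarrow> (\<forall>n\<in>N. n \<bullet> y \<noteq> 0)" for y
    by (auto simp: S_def)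
  have sub: "cell N x \<subseteq> S"
    using cell_self by (auto simp: S self_in_cell_iff[symmetric])
  have "connected_component_set S x = cell N x"
  proof
    show "cell N x \<subseteq> connected_component_set S x"
      using x sub convex_cell convex_connected by (intro connected_component_maximal) auto
    show "connected_component_set S x \<subseteq> cell N x"
    proof
      fix y assume y: "y \<in> connected_component_set S x"
      let ?C = "connected_component_set S x"
      have xC: "x \<in> ?C"
        using x sub by (auto simp: connected_component_refl_eq)
      show "y \<in> cell N x"
        unfolding cell_def
      proof (intro CollectI ballI, rule ccontr)
        fix n assume n: "n \<in> N" and "\<not> 0 < (n \<bullet> x) * (n \<bullet> y)"
        moreover have nz: "n \<bullet> z \<noteq> 0" if "z \<in> ?C" for z
          using that n connected_component_subset S by blast
        ultimately consider "n \<bullet> x \<le> 0" "0 \<le> n \<bullet> y" | "n \<bullet> y \<le> 0" "0 \<le> n \<bullet> x"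
          using nz[OF xC] nz[OF y]
          by (cases "n \<bullet> x \<le> 0"; cases "n \<bullet> y \<le> 0") (auto simp: zero_less_mult_iff)
        then show False
        proof cases
          case 1
          then obtain z where "z \<in> ?C" "n \<bullet> z = 0"
            using connected_ivt_hyperplane[OF connected_connected_component xC y] by blast
          then show False
            using nz by blast
        next
          case 2
          then obtain z where "z \<in> ?C" "n \<bullet> z = 0"
            using connected_ivt_hyperplane[OF connected_connected_component y xC] by blast
          then show False
            using nz by blast
        qed
      qed
    qed
  qed
  then show ?thesis
    unfolding regions_def S_def[symmetric] components_def using x sub by blast
qed

lemma plane_unit_normal:
  fixes H :: "(real^3) set"
  assumes "subspace H" "dim H = 2"
  obtains n where "norm n = 1" "H = {x. n \<bullet> x = 0}"
proof -
  obtain a where a: "a \<noteq> 0" "span H \<subseteq> {x. a \<bullet> x = 0}"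
    using lowdim_subset_hyperplane[of H] assms(2) by auto
  have "H = {x. a \<bullet> x = 0}"
  proof (rule subspace_dim_equal)
    show "dim {x. a \<bullet> x = 0} \<le> dim H"
      using dim_hyperplane[OF a(1)] assms(2) by simp
  qed (use a(2) assms(1) span_superset[of H] subspace_hyperplane[of a] in auto)
  then show ?thesis
    using a(1) by (intro that[of "(1 / norm a) *\<^sub>R a"]) auto
qed

text \<open>If all normals are orthogonal to a line, the plane orthogonal to that line is added; the
  regions of the larger arrangement are still congruent.\<close>

lemma (in unit_normals) planar_reflection_closed:
  assumes n1: "n1 \<in> N" and n2: "n2 \<in> N" and ne: "n2 \<noteq> n1" "n2 \<noteq> - n1"
    and flat: "\<And>n. n \<in> N \<Longrightarrow> det3 n n1 n2 = 0"
    and iso: "\<And>x y. x \<in> cell N x \<Longrightarrow> y \<in> cell N y \<Longrightarrow>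
      \<exists>U. orthogonal_transformation U \<and> U ` cell N x = cell N y"
    and nm: "n \<in> N" "m \<in> N"
  shows "reflection_along n m \<in> N"
proof -
  have "cross3 n1 n2 \<noteq> 0"
  proof
    assume c: "cross3 n1 n2 = 0"
    have "(n1 \<bullet> n1) * (n2 \<bullet> n2) - (n1 \<bullet> n2) * (n1 \<bullet> n2) = 0"
      using dot_cross[of n1 n2 n1 n2] c by (simp add: inner_commute)
    then have "(n1 \<bullet> n2)\<^sup>2 = 1"
      using norm_N n1 n2 by (simp add: norm_eq_1 power2_eq_square)
    then have "\<bar>n1 \<bullet> n2\<bar> = norm n1 * norm n2"
      using norm_N n1 n2 by (simp add: abs_square_eq_1)
    then show False
      using norm_cauchy_schwarz_abs_eq[of n1 n2] ne norm_N n1 n2 by auto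
  qed
  \<comment> \<open>The normalised cross product spans the common line of all planes.\<close>
  then obtain v where v: "norm v = 1" "det3 v n1 n2 \<noteq> 0" and vperp: "\<And>n. n \<in> N \<Longrightarrow> n \<bullet> v = 0"
    using flat
    by (intro that[of "(1 / norm (cross3 n1 n2)) *\<^sub>R cross3 n1 n2"]) (auto simp: det3_def)
  have vv: "v \<bullet> v = 1"
    using v(1) by (simp add: norm_eq_1)
  let ?L = "insert v (insert (- v) N)"
  interpret L: unit_normals ?L
    using finite_N norm_N uminus_N v(1) by unfold_locales auto
  have cellL: "cell ?L x = {y \<in> cell N x. 0 < (v \<bullet> x) * (v \<bullet> y)}" for x
    by (auto simp: cell_def)
  have isoL: "\<exists>U. orthogonal_transformation U \<and> U ` cell ?L x = cell ?L y"
    if xL: "x \<in> cell ?L x" and yL: "y \<in> cell ?L y" for x y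
  proof -
    have x: "x \<in> cell N x" "v \<bullet> x \<noteq> 0" and y: "y \<in> cell N y" "v \<bullet> y \<noteq> 0"
      using xL yL unfolding cellL by auto
    obtain U where U: "orthogonal_transformation U" "U ` cell N x = cell N y"
      using iso[OF x(1) y(1)] by blast
    have linU: "linear U" and innU: "\<And>z w. U z \<bullet> U w = z \<bullet> w"
      using U(1) by (auto simp: orthogonal_transformation_def)
    \<comment> \<open>Cells are invariant under translation along \<open>v\<close>. If
      \<open>n\<close> were nonzero on \<open>U v\<close>, a suitable translation would carry the
      image point onto the plane of \<open>n\<close>, out of the cell.\<close>
    have perp: "n \<bullet> U v = 0" if n: "n \<in> N" for n
    proof (rule ccontr)
      assume nz: "n \<bullet> U v \<noteq> 0"
      define s where "s = - (n \<bullet> U x) / (n \<bullet> U v)"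
      have "x + s *\<^sub>R v \<in> cell N x"
        using x(1) vperp by (simp add: cell_def inner_add_right)
      then have "U (x + s *\<^sub>R v) \<in> cell N y"
        using U(2) by blast
      then have "n \<bullet> U (x + s *\<^sub>R v) \<noteq> 0"
        using n by (auto simp: cell_def)
      moreover have "n \<bullet> U (x + s *\<^sub>R v) = 0"
        unfolding linear_add[OF linU] linear_scale[OF linU] inner_add_right
        using nz by (simp add: s_def)
      ultimately show False
        by simp
    qed
    have "norm (U v) = 1"
      using orthogonal_transformation_norm[OF U(1)] v(1) by simp
    moreover have "det3 n1 n2 v \<noteq> 0"
      using v(2) det3_eq_0_iff_swap by metis
    ultimately have "U v = v \<or> U v = - v"
      using perp vperp n1 n2 v(1) by (intro unit_orthogonal_unique) (auto simp: inner_commute)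
    then obtain \<kappa> where \<kappa>: "\<kappa> = 1 \<or> \<kappa> = - 1" "\<And>z. v \<bullet> U z = \<kappa> * (v \<bullet> z)"
    proof
      assume e: "U v = v"
      show ?thesis
        by (rule that[of 1]) (use innU[of v] e in auto)
    next
      assume e: "U v = - v"
      show ?thesis
        by (rule that[of "- 1"]) (use innU[of v] e in \<open>auto simp: minus_equation_iff\<close>)
    qed
    \<comment> \<open>The map \<open>U\<close> respects the old cells but may interchange the sides
      of the added plane; composing with the reflection in that plane corrects this and keeps the
      old cells.\<close>
    obtain V \<mu> where V: "orthogonal_transformation V" "V ` cell N x = cell N y"
      "\<And>z. v \<bullet> V z = \<mu> * (v \<bullet> z)" "0 < (v \<bullet> x) * (v \<bullet> y) * \<mu>"
    proof (cases "0 < (v \<bullet> x) * (v \<bullet> y) * \<kappa>")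
      case True
      then show ?thesis
        using that U \<kappa> by blast
    next
      case False
      let ?r = "reflection_along v"
      have "v \<noteq> 0"
        using v(1) by auto
      have r: "n \<bullet> ?r z = n \<bullet> z" if "n \<in> N" for n z
        using vperp[OF that] by (simp add: reflection_along_def inner_diff_right)
      have rv: "v \<bullet> ?r z = - (v \<bullet> z)" for z
        using v(1) vv by (simp add: reflection_along_unit inner_diff_right)
      have sub: "?r ` cell N y \<subseteq> cell N y"
        by (auto simp: cell_def r)
      then have "?r ` cell N y = cell N y"
        using reflection_along_involution[of v] by (metis image_subset_iff imageI subsetI subset_antisym)
      then have "(?r \<circ> U) ` cell N x = cell N y"
        using U(2) by (metis image_comp)
      moreover have "orthogonal_transformation (?r \<circ> U)"
        by (rule orthogonal_transformation_compose[OF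
              orthogonal_transformation_reflection_along[OF \<open>v \<noteq> 0\<close>] U(1)])
      moreover have "(v \<bullet> x) * (v \<bullet> y) * \<kappa> \<noteq> 0"
        using x(2) y(2) \<kappa>(1) by auto
      then have "0 < (v \<bullet> x) * (v \<bullet> y) * (- \<kappa>)"
        using False by (metis linorder_neqE_linordered_idom mult_minus_right neg_0_less_iff_less)
      ultimately show ?thesis
        by (intro that[of "?r \<circ> U" "- \<kappa>"]) (auto simp: rv \<kappa>(2))
    qed
    have iff: "0 < (v \<bullet> y) * (v \<bullet> V z) \<longleftrightarrow> 0 < (v \<bullet> x) * (v \<bullet> z)" for z
      using V(4) unfolding V(3) by (auto simp: zero_less_mult_iff mult_less_0_iff)
    have "V ` cell ?L x = cell ?L y"
      unfolding cellL V(2)[symmetric] using iff by auto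
    then show ?thesis
      using V(1) by blast
  qed
  have "reflection_along n m \<in> ?L"
    by (rule L.essential_reflection_closed[of v n1 n2, OF _ _ _ v(2) isoL]) (use n1 n2 nm in auto)
  \<comment> \<open>The reflected normal is orthogonal to \<open>v\<close>, so it is neither of the
    two added normals.\<close>
  moreover have "reflection_along n m \<bullet> v = 0"
    using vperp nm by (simp add: reflection_along_def inner_diff_left)
  ultimately show ?thesis
    using vv by auto
qed

text \<open>Split by rank. If any three normals are dependent, \<open>n\<close> and \<open>m\<close>
  themselves serve as the two spanning normals of the planar case; parallel normals only change
  sign, which settles a single plane.\<close>

lemma (in unit_normals) isometric_reflection_closed:
  assumes iso: "\<And>x y. x \<in> cell N x \<Longrightarrow> y \<in> cell N y \<Longrightarrow>
      \<exists>U. orthogonal_transformation U \<and> U ` cell N x = cell N y"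
    and nm: "n \<in> N" "m \<in> N"
  shows "reflection_along n m \<in> N"
proof -
  consider f g h where "f \<in> N" "g \<in> N" "h \<in> N" "det3 f g h \<noteq> 0"
    | "\<And>f g h. f \<in> N \<Longrightarrow> g \<in> N \<Longrightarrow> h \<in> N \<Longrightarrow> det3 f g h = 0" "m \<noteq> n" "m \<noteq> - n"
    | "m = n \<or> m = - n"
    by blast
  then show ?thesis
  proof cases
    case 1
    then show ?thesis
      using essential_reflection_closed iso nm by blast
  next
    case 2
    then show ?thesis
      using planar_reflection_closed[OF nm 2(2,3)] iso nm by blast
  next
    case 3
    have "reflection_along n n = - n" "reflection_along n (- n) = n"
      using norm_N[OF nm(1)] by (simp_all add: reflection_along_unit norm_eq_1 scaleR_2)
    then show ?thesis
      using 3 nm uminus_N by auto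
  qed
qed

theorem theorem1p2:
  fixes A :: "(real ^ 3) set set"
  assumes "finite A"
    and "\<And>H. H \<in> A \<Longrightarrow> subspace H \<and> dim H = 2"
    and "\<And>R R'. R \<in> regions A \<Longrightarrow> R' \<in> regions A \<Longrightarrow>
           \<exists>f. euclidean_isometry f \<and> f ` R = R'"
  shows "coxeter_arrangement A"
proof -
  \<comment> \<open>Both unit normals of every plane; the plane determines them up to sign, whence
    finiteness.\<close>
  define N :: "(real^3) set" where "N = {n. norm n = 1 \<and> {x. n \<bullet> x = 0} \<in> A}"
  have A: "A = (\<lambda>n. {x. n \<bullet> x = 0}) ` N"
  proof (intro equalityI subsetI)
    fix H assume "H \<in> A"
    then obtain n where "norm n = 1" "H = {x. n \<bullet> x = 0}"
      using assms(2) plane_unit_normal by metis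
    then show "H \<in> (\<lambda>n. {x. n \<bullet> x = 0}) ` N"
      using \<open>H \<in> A\<close> by (auto simp: N_def)
  qed (auto simp: N_def)
  have "finite {n :: real^3. norm n = 1 \<and> {x. n \<bullet> x = 0} = H}" for H
  proof (cases "\<exists>k :: real^3. norm k = 1 \<and> {x. k \<bullet> x = 0} = H")
    case True
    then obtain k :: "real^3" where k: "norm k = 1" "{x. k \<bullet> x = 0} = H"
      by blast
    have "{n :: real^3. norm n = 1 \<and> {x. n \<bullet> x = 0} = H} \<subseteq> {k, - k}"
      using unit_hyperplane_unique[OF _ k(1)] k(2) by blast
    then show ?thesis
      by (rule finite_subset) simp
  next
    case False
    then have "{n :: real^3. norm n = 1 \<and> {x. n \<bullet> x = 0} = H} = {}"
      by blast
    then show ?thesis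
      by (simp only: finite.emptyI)
  qed
  moreover have "N = (\<Union>H\<in>A. {n. norm n = 1 \<and> {x. n \<bullet> x = 0} = H})"
    by (auto simp: N_def)
  ultimately have fin: "finite N"
    using assms(1) by simp
  interpret unit_normals N
    using fin by unfold_locales (auto simp: N_def)
  have iso: "\<exists>U. orthogonal_transformation U \<and> U ` cell N x = cell N y"
    if xy: "x \<in> cell N x" "y \<in> cell N y" for x y
  proof -
    obtain f where f: "euclidean_isometry f" "f ` cell N x = cell N y"
      using assms(3) cell_in_regions[OF xy(1)] cell_in_regions[OF xy(2)] unfolding A by metis
    then show ?thesis
      using isometric_cones[OF open_cell[OF fin] convex_cell cell_scaleR open_cell[OF fin] convex_cell
          cell_scaleR f] by metis
  qed
  show ?thesis
    unfolding A using closed_imp_coxeter isometric_reflection_closed[OF iso] by blast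
qed

end
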